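(* Let $n\ge 11$ and let $G\in\mathbb{G}_{n,3}$. (i) If $n=3m$, then $\rho(G)\ge\rho(G_2(m-2,m-3,m-2))$, with equality if and only if $G\cong G_2(m-2,m-3,m-2)$. (ii) If $n=3m+1$, then $\rho(G)\ge\rho(G_2(m-1,m-4,m-1))$, with equality if and only if $G\cong G_2(m-1,m-4,m-1)$. (iii) If $n=3m+2$, then $\rho(G)\ge\rho(G_2(m-1,m-3,m-1))$, with equality if and only if $G\cong G_2(m-1,m-3,m-1)$.
   Context: $\rho(G)$ denotes the spectral radius (largest adjacency eigenvalue) of $G$. The domination number of a graph is the minimum size of a vertex set $D$ such that every vertex outside $D$ is adjacent to a vertex of $D$. $\mathbb{G}_{n,3}$ is the set of simple connected graphs on $n$ vertices with domination number $3$. For nonnegative integers $a,b,c$, $G_2(a,b,c)$ is the graph obtained from the path $v_1v_4v_5v_2v_6v_7v_3$ by attaching $a$ pendent edges at $v_1$, $b$ pendent edges at $v_2$ and $c$ pendent edges at $v_3$. *)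

theory Defs
  imports
    "Graph_Theory.Graph_Theory"
    "Jordan_Normal_Form.Spectral_Radius"
begin

text \<open>A finite simple graph is a \<open>pair_graph\<close>: each undirected edge \<open>uv\<close> is
  represented by the two arcs \<open>(u, v)\<close> and \<open>(v, u)\<close>.\<close>

definition adj_mat :: "'a pair_pre_digraph \<Rightarrow> 'a list \<Rightarrow> real mat" where
  "adj_mat G vs = mat (length vs) (length vs)
     (\<lambda>(i, j). if (vs ! i, vs ! j) \<in> parcs G then 1 else 0)"

text \<open>The vertex ordering used to write down the adjacency matrix is immaterial, see
  \<open>rho_eq\<close> below. As the matrix is symmetric, its real eigenvalues are all of its
  eigenvalues.\<close>

definition rho :: "'a pair_pre_digraph \<Rightarrow> real" where
  "rho G = Max (spectrum (adj_mat G (SOME vs. distinct vs \<and> set vs = pverts G)))"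

definition dominating :: "'a pair_pre_digraph \<Rightarrow> 'a set \<Rightarrow> bool" where
  "dominating G D \<longleftrightarrow> D \<subseteq> pverts G \<and> (\<forall>v \<in> pverts G - D. \<exists>u \<in> D. (v, u) \<in> parcs G)"

definition domination_number :: "'a pair_pre_digraph \<Rightarrow> nat" where
  "domination_number G = Min (card ` {D. dominating G D})"

definition conn_graphs_dom :: "nat \<Rightarrow> nat \<Rightarrow> 'a pair_pre_digraph set" where
  "conn_graphs_dom n k = {G. pair_graph G \<and> Digraph_Component.connected (with_proj G) \<and>
     card (pverts G) = n \<and> domination_number G = k}"

text \<open>\<open>V i\<close> is the path vertex $v_i$ and \<open>Pend i j\<close> is the \<open>j\<close>-th pendent
  vertex attached at $v_i$.\<close>

datatype g2_vertex = V nat | Pend nat nat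

definition G2_edges :: "nat \<Rightarrow> nat \<Rightarrow> nat \<Rightarrow> g2_vertex rel" where
  "G2_edges a b c =
     {(V 1, V 4), (V 4, V 5), (V 5, V 2), (V 2, V 6), (V 6, V 7), (V 7, V 3)}
     \<union> {(V 1, Pend 1 j) | j. j < a}
     \<union> {(V 2, Pend 2 j) | j. j < b}
     \<union> {(V 3, Pend 3 j) | j. j < c}"

definition G2 :: "nat \<Rightarrow> nat \<Rightarrow> nat \<Rightarrow> g2_vertex pair_pre_digraph" where
  "G2 a b c = \<lparr> pverts = V ` {1..7} \<union> Pend 1 ` {..<a} \<union> Pend 2 ` {..<b} \<union> Pend 3 ` {..<c},
                parcs = G2_edges a b c \<union> (G2_edges a b c)\<inverse> \<rparr>"

lemma eigenvalue_adj_mat: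
  assumes vs: "distinct vs" "set vs = pverts G"
  shows "eigenvalue (adj_mat G vs) k \<longleftrightarrow>
    (\<exists>f. (\<exists>v \<in> pverts G. f v \<noteq> 0) \<and>
         (\<forall>v \<in> pverts G. (\<Sum>u \<in> {u \<in> pverts G. (v, u) \<in> parcs G}. f u) = k * f v))"
proof -
  let ?n = "length vs"
  have fin: "finite (pverts G)" using vs(2) by (metis List.finite_set)
  have bij: "bij_betw ((!) vs) {..<?n} (pverts G)"
    using vs by (metis bij_betw_nth)
  have row: "(adj_mat G vs *\<^sub>v x) $ i =
      (\<Sum>u \<in> {u \<in> pverts G. (vs ! i, u) \<in> parcs G}. f u)"
    if i: "i < ?n" and x: "x \<in> carrier_vec ?n" and f: "\<And>j. j < ?n \<Longrightarrow> x $ j = f (vs ! j)"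
    for x i and f :: "'a \<Rightarrow> real"
  proof -
    have "(adj_mat G vs *\<^sub>v x) $ i =
        (\<Sum>j \<in> {..<?n}. (if (vs ! i, vs ! j) \<in> parcs G then f (vs ! j) else 0))"
      using i x f by (auto simp: adj_mat_def scalar_prod_def atLeast0LessThan intro!: sum.cong)
    also have "\<dots> = (\<Sum>u \<in> pverts G. (if (vs ! i, u) \<in> parcs G then f u else 0))"
      by (rule sum.reindex_bij_betw[OF bij])
    also have "\<dots> = (\<Sum>u \<in> {u \<in> pverts G. (vs ! i, u) \<in> parcs G}. f u)"
      by (simp add: sum.inter_filter fin)
    finally show ?thesis .
  qed
  have dim: "dim_row (adj_mat G vs) = ?n" by (simp add: adj_mat_def)
  show ?thesis
  proof
    assume "eigenvalue (adj_mat G vs) k"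
    then obtain x where x: "x \<in> carrier_vec ?n" "x \<noteq> 0\<^sub>v ?n" "adj_mat G vs *\<^sub>v x = k \<cdot>\<^sub>v x"
      by (auto simp: eigenvalue_def eigenvector_def dim)
    define f where "f v = x $ (the_inv_into {..<?n} ((!) vs) v)" for v
    have f: "x $ j = f (vs ! j)" if "j < ?n" for j
      using that bij by (auto simp: f_def bij_betw_def the_inv_into_f_f)
    from x(1,2) obtain i where i: "i < ?n" "x $ i \<noteq> 0" by fastforce
    have "f (vs ! i) \<noteq> 0" "vs ! i \<in> pverts G" using i f vs(2) by auto
    moreover have "(\<Sum>u \<in> {u \<in> pverts G. (v, u) \<in> parcs G}. f u) = k * f v"
      if v: "v \<in> pverts G" for v
    proof -
      obtain j where j: "j < ?n" "v = vs ! j" using v vs(2) by (metis in_set_conv_nth)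
      show ?thesis using row[OF j(1) x(1) f] x j f by simp
    qed
    ultimately show "\<exists>f. (\<exists>v \<in> pverts G. f v \<noteq> 0) \<and>
         (\<forall>v \<in> pverts G. (\<Sum>u \<in> {u \<in> pverts G. (v, u) \<in> parcs G}. f u) = k * f v)" by blast
  next
    assume "\<exists>f. (\<exists>v \<in> pverts G. f v \<noteq> 0) \<and>
         (\<forall>v \<in> pverts G. (\<Sum>u \<in> {u \<in> pverts G. (v, u) \<in> parcs G}. f u) = k * f v)"
    then obtain f v where f: "v \<in> pverts G" "f v \<noteq> 0"
      "\<And>v. v \<in> pverts G \<Longrightarrow> (\<Sum>u \<in> {u \<in> pverts G. (v, u) \<in> parcs G}. f u) = k * f v" by blast
    define x where "x = vec ?n (\<lambda>j. f (vs ! j))"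
    have x: "x \<in> carrier_vec ?n" by (simp add: x_def)
    obtain i where i: "i < ?n" "v = vs ! i" using f(1) vs(2) by (metis in_set_conv_nth)
    have "x $ i \<noteq> 0" using i f(2) by (simp add: x_def)
    hence "x \<noteq> 0\<^sub>v ?n" using i by auto
    moreover have "adj_mat G vs *\<^sub>v x = k \<cdot>\<^sub>v x"
    proof (rule eq_vecI)
      fix j assume "j < dim_vec (k \<cdot>\<^sub>v x)"
      hence j: "j < ?n" by (simp add: x_def)
      have "vs ! j \<in> pverts G" using nth_mem[OF j] unfolding vs(2) .
      hence "(adj_mat G vs *\<^sub>v x) $ j = k * f (vs ! j)"
        by (subst row[OF j x, of f]) (simp_all add: x_def f(3))
      thus "(adj_mat G vs *\<^sub>v x) $ j = (k \<cdot>\<^sub>v x) $ j"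
        using j by (simp add: x_def)
    qed (simp add: x_def dim)
    ultimately show "eigenvalue (adj_mat G vs) k"
      using x by (auto simp: eigenvalue_def eigenvector_def dim)
  qed
qed

lemma rho_eq:
  assumes vs: "distinct vs" "set vs = pverts G"
  shows "rho G = Max (spectrum (adj_mat G vs))"
proof -
  define ws where "ws = (SOME vs. distinct vs \<and> set vs = pverts G)"
  have "distinct ws \<and> set ws = pverts G"
    unfolding ws_def by (rule someI[of _ vs]) (use vs in simp)
  hence ws: "distinct ws" "set ws = pverts G" by auto
  have "spectrum (adj_mat G ws) = spectrum (adj_mat G vs)"
    unfolding spectrum_def eigenvalue_adj_mat[OF vs] eigenvalue_adj_mat[OF ws] by (rule refl)
  thus ?thesis
    by (simp only: rho_def ws_def)
qed

lemma pair_graph_G2: "pair_graph (G2 a b c)"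
proof -
  have fin: "finite (G2_edges a b c)" by (simp add: G2_edges_def)
  have "symmetric (with_proj (G2 a b c))"
    unfolding symmetric_def by (rule symI) (auto simp: G2_def)
  thus ?thesis
    using fin by unfold_locales (auto simp: G2_def G2_edges_def)
qed

lemma card_G2: "card (pverts (G2 a b c)) = a + b + c + 7"
proof -
  let ?P = "V ` {1..7}" and ?A = "Pend 1 ` {..<a}" and ?B = "Pend 2 ` {..<b}"
    and ?C = "Pend 3 ` {..<c}"
  have P: "card ?P = 7"
    by (subst card_image) (simp_all add: inj_on_def)
  have Pend: "card (Pend i ` {..<k}) = k" for i k
    by (subst card_image) (simp_all add: inj_on_def)
  have "card (?P \<union> ?A \<union> ?B \<union> ?C) = card (?P \<union> ?A \<union> ?B) + card ?C"
    by (rule card_Un_disjoint) auto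
  also have "card (?P \<union> ?A \<union> ?B) = card (?P \<union> ?A) + card ?B"
    by (rule card_Un_disjoint) auto
  also have "card (?P \<union> ?A) = card ?P + card ?A"
    by (rule card_Un_disjoint) auto
  finally show ?thesis
    unfolding P Pend by (simp add: G2_def)
qed

end

theory Submission
  imports Defs "HOL-Analysis.Function_Topology"
begin

text \<open>
  A minimum dominating set splits the vertices of \<open>G\<close> into three stars with centres
  \<open>c1, c2, c3\<close>; by connectivity two edges link star 1 to star 2 and star 2 to star 3, and these
  stars and links form a spanning tree. Fix \<open>l > 1\<close> with \<open>rho G \<le> l\<close> and put \<open>q = l\<^sup>2\<close>. Testing the
  Rayleigh quotient with values \<open>x, y, z \<ge> 0\<close> at the centres, extended to the other vertices by
  solving the eigenvalue equation there, gives a quadratic inequality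
  \<open>L p x y + L r y z \<le> (q - d1) x\<^sup>2 + (q - d2) y\<^sup>2 + (q - d3) z\<^sup>2\<close>, where \<open>p, r \<in> {1, 2, 3}\<close> are the
  distances between linked centres, the \<open>di\<close> are the degrees of the centres in the tree and
  \<open>d1 + d2 + d3 = n + 3 - p - r\<close>. Moreover all degrees are less than \<open>q\<close>.

  For \<open>l\<close> the spectral radius of the extremal graph, \<open>q\<close> is a root of an explicit equation and
  close to \<open>n / 3\<close>, so only few triples of degrees remain, and all but the extremal one contradict the inequality at a suitable \<open>(x, y, z)\<close>. At the extremal one the inequality is
  tight at a positive point, so \<open>G\<close> has no further edges.
\<close>

section \<open>The spectral radius as a maximum of the Rayleigh quotient\<close>

definition adj_sum :: "'a pair_pre_digraph \<Rightarrow> ('a \<Rightarrow> real) \<Rightarrow> 'a \<Rightarrow> real" where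
  "adj_sum G f v = (\<Sum>u \<in> {u \<in> pverts G. (v, u) \<in> parcs G}. f u)"

text \<open>The bilinear form of the adjacency matrix. Summing over arcs counts each undirected edge
  in both directions.\<close>

definition adj_form :: "'a pair_pre_digraph \<Rightarrow> ('a \<Rightarrow> real) \<Rightarrow> ('a \<Rightarrow> real) \<Rightarrow> real" where
  "adj_form G f g = (\<Sum>(u, v) \<in> parcs G. f u * g v)"

lemma adj_form_altdef:
  assumes "pair_graph G"
  shows "adj_form G f g = (\<Sum>v \<in> pverts G. f v * adj_sum G g v)"
proof -
  interpret pair_graph G by fact
  have fin: "finite (pverts G)" by (rule pair_finite_verts)
  have eq: "parcs G = (SIGMA v : pverts G. {u \<in> pverts G. (v, u) \<in> parcs G})"
    using arc_fst_in_verts arc_snd_in_verts by force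
  have "(\<Sum>v \<in> pverts G. f v * adj_sum G g v) =
      (\<Sum>v \<in> pverts G. \<Sum>u \<in> {u \<in> pverts G. (v, u) \<in> parcs G}. f v * g u)"
    by (simp add: adj_sum_def sum_distrib_left)
  also have "\<dots> = (\<Sum>(v, u) \<in> (SIGMA v : pverts G. {u \<in> pverts G. (v, u) \<in> parcs G}). f v * g u)"
    by (rule sum.Sigma) (use fin in auto)
  also have "\<dots> = adj_form G f g"
    unfolding adj_form_def by (rule sum.cong[OF eq[symmetric] refl])
  finally show ?thesis by simp
qed

lemma arcs_sym:
  assumes "pair_graph G" "(u, v) \<in> parcs G"
  shows "(v, u) \<in> parcs G"
proof -
  interpret pair_graph G by fact
  show ?thesis using pair_sym_arcs assms(2) by (auto simp: symmetric_def dest: symD)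
qed

lemma adj_form_commute:
  assumes "pair_graph G"
  shows "adj_form G f g = adj_form G g f"
  unfolding adj_form_def
  by (rule sum.reindex_bij_witness[of _ prod.swap prod.swap])
     (use arcs_sym[OF assms] in \<open>auto simp: mult.commute\<close>)

lemma adj_form_add_scaled:
  "adj_form G (\<lambda>v. f v + t * g v) (\<lambda>v. f v + t * g v) =
     adj_form G f f + t * (adj_form G f g + adj_form G g f) + t\<^sup>2 * adj_form G g g"
  unfolding adj_form_def case_prod_beta
  by (simp add: sum.distrib sum_distrib_left algebra_simps power2_eq_square)

lemma nonneg_quadratic_linear_coeff_zero:
  fixes a b :: real
  assumes "\<And>t. 2 * t * a + t\<^sup>2 * b \<ge> 0"
  shows "a = 0"
proof (rule ccontr)
  assume a: "a \<noteq> 0"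
  \<comment> \<open>For small \<open>t\<close> the linear term dominates; this \<open>k\<close>
    makes the step \<open>- a / k\<close> short enough for the value to be negative.\<close>
  define k where "k = \<bar>b\<bar> + 1"
  have k: "k > 0" "b < k" by (auto simp: k_def)
  have "2 * (- a / k) * a + (- a / k)\<^sup>2 * b = (a\<^sup>2 / k) * (b / k - 2)"
    using k by (simp add: field_simps power2_eq_square)
  also have "\<dots> < 0"
    using a k by (intro mult_pos_neg) (auto simp: field_simps)
  finally show False using assms[of "- a / k"] by linarith
qed

text \<open>First-order condition: moving the maximiser \<open>f\<close> along the indicator of
  \<open>w\<close> gives a nonnegative quadratic in the step \<open>t\<close> that vanishes at
  \<open>t = 0\<close>, so its linear coefficient, twice \<open>k * f w - adj_sum G f w\<close>, is
  zero.\<close>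

lemma rayleigh_maximiser_eigenfunction:
  assumes G: "pair_graph G"
    and max: "\<And>g. adj_form G g g \<le> k * (\<Sum>v \<in> pverts G. (g v)\<^sup>2)"
    and eq: "adj_form G f f = k * (\<Sum>v \<in> pverts G. (f v)\<^sup>2)"
    and w: "w \<in> pverts G"
  shows "adj_sum G f w = k * f w"
proof -
  interpret pair_graph G by fact
  let ?V = "pverts G"
  have fin: "finite ?V" by (rule pair_finite_verts)
  define g :: "'a \<Rightarrow> real" where "g v = of_bool (v = w)" for v
  have gf: "adj_form G g f = adj_sum G f w"
    unfolding adj_form_altdef[OF G] g_def using w fin by (simp add: if_distrib cong: if_cong)
  have fg: "(\<Sum>v\<in>?V. f v * g v) = f w" and gg: "(\<Sum>v\<in>?V. (g v)\<^sup>2) = 1"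
    unfolding g_def using w fin by (simp_all add: if_distrib power2_eq_square cong: if_cong)
  have "2 * t * (k * f w - adj_sum G f w) + t\<^sup>2 * (k - adj_form G g g) \<ge> 0" for t
  proof -
    have "(\<Sum>v\<in>?V. (f v + t * g v)\<^sup>2) = (\<Sum>v\<in>?V. (f v)\<^sup>2) + 2 * t * (\<Sum>v\<in>?V. f v * g v) + t\<^sup>2 * (\<Sum>v\<in>?V. (g v)\<^sup>2)"
      by (simp add: sum_distrib_left sum.distrib algebra_simps power2_eq_square)
    hence "adj_form G f f + t * (adj_form G g f + adj_form G g f) + t\<^sup>2 * adj_form G g g
        \<le> k * ((\<Sum>v\<in>?V. (f v)\<^sup>2) + 2 * t * f w + t\<^sup>2 * 1)"
      using max[of "\<lambda>v. f v + t * g v"]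
      unfolding adj_form_add_scaled fg gg adj_form_commute[OF G, of f g] by simp
    thus ?thesis unfolding eq gf by (simp add: algebra_simps)
  qed
  from nonneg_quadratic_linear_coeff_zero[OF this] show ?thesis by simp
qed

lemma rayleigh_maximum_exists:
  assumes G: "pair_graph G" and ne: "pverts G \<noteq> {}"
  obtains f k where "(\<Sum>v \<in> pverts G. (f v)\<^sup>2) = 1" "adj_form G f f = k"
    "\<And>g. adj_form G g g \<le> k * (\<Sum>v \<in> pverts G. (g v)\<^sup>2)"
proof -
  interpret pair_graph G by fact
  let ?V = "pverts G"
  have fin: "finite ?V" by (rule pair_finite_verts)
  \<comment> \<open>Functions live on the whole type, so they are pinned to 0 off the vertices. The
    product of these compact sets is compact by Tychonoff, and the unit sphere is closed in
    it.\<close>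
  define B :: "'a \<Rightarrow> real set" where "B v = (if v \<in> ?V then {-1..1} else {0})" for v
  define S where "S = PiE UNIV B \<inter> {f. (\<Sum>v\<in>?V. (f v)\<^sup>2) = 1}"
  have cont: "continuous_on UNIV (\<lambda>f::'a \<Rightarrow> real. f v)" for v
    by (rule continuous_on_product_coordinates)
  have "compact (PiE UNIV B)"
    using compactin_PiE[of "\<lambda>_. euclidean :: real topology" UNIV B]
    by (auto simp: euclidean_product_topology B_def)
  moreover have "closed {f :: 'a \<Rightarrow> real. (\<Sum>v\<in>?V. (f v)\<^sup>2) = 1}"
    by (intro closed_Collect_eq continuous_on_sum continuous_on_power continuous_on_const cont)
  ultimately have "compact S" unfolding S_def by (rule compact_Int_closed)
  moreover obtain w where w: "w \<in> ?V" using ne by auto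
  have "(\<lambda>v. of_bool (v = w)) \<in> S"
    using w fin by (auto simp: S_def B_def if_distrib power2_eq_square cong: if_cong)
  hence "S \<noteq> {}" by auto
  moreover have "continuous_on S (\<lambda>f. adj_form G f f)"
    unfolding adj_form_def case_prod_unfold
    by (intro continuous_on_sum continuous_on_mult continuous_on_subset[OF cont]) auto
  ultimately obtain f where f: "f \<in> S" "\<And>g. g \<in> S \<Longrightarrow> adj_form G g g \<le> adj_form G f f"
    using continuous_attains_sup[of S "\<lambda>f. adj_form G f f"] by blast
  show ?thesis
  proof (rule that[of f "adj_form G f f"])
    show "(\<Sum>v\<in>?V. (f v)\<^sup>2) = 1" using f(1) by (simp add: S_def)
    fix g :: "'a \<Rightarrow> real"
    let ?N = "\<Sum>v\<in>?V. (g v)\<^sup>2"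
    show "adj_form G g g \<le> adj_form G f f * ?N"
    proof (cases "?N = 0")
      case True
      hence "g v = 0" if "v \<in> ?V" for v using that fin by (simp add: sum_nonneg_eq_0_iff)
      hence "adj_form G g g = 0" by (simp add: adj_form_altdef[OF G])
      thus ?thesis using True by simp
    next
      case False
      have N: "?N > 0" using False by (simp add: sum_nonneg less_le)
      define g' where "g' v = (if v \<in> ?V then g v / sqrt ?N else 0)" for v
      have sq: "(g' v)\<^sup>2 = (g v)\<^sup>2 / ?N" if "v \<in> ?V" for v
        using that N by (simp add: g'_def power_divide)
      have s1: "(\<Sum>v\<in>?V. (g' v)\<^sup>2) = 1"
        using N by (simp add: sq sum_divide_distrib[symmetric])
      have "g' v \<in> B v" for v
      proof (cases "v \<in> ?V")
        case True
        have "(g' v)\<^sup>2 \<le> 1" using True fin unfolding s1[symmetric]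
          by (intro member_le_sum) auto
        thus ?thesis using True by (auto simp: B_def abs_square_le_1 abs_le_iff)
      qed (simp add: B_def g'_def)
      hence "g' \<in> S" using s1 by (auto simp: S_def)
      from f(2)[OF this] have "adj_form G g' g' \<le> adj_form G f f" .
      moreover have "adj_form G g' g' = adj_form G g g / ?N"
      proof -
        have "adj_form G g' g' = (\<Sum>e\<in>parcs G. g (fst e) * g (snd e) / ?N)"
          unfolding adj_form_def case_prod_unfold
          using N arc_fst_in_verts arc_snd_in_verts
          by (intro sum.cong) (simp_all add: g'_def)
        thus ?thesis by (simp add: adj_form_def case_prod_unfold sum_divide_distrib)
      qed
      ultimately show ?thesis using N by (simp add: field_simps)
    qed
  qed simp
qed

text \<open>The maximal Rayleigh quotient \<open>k\<close> is an eigenvalue, as a maximiser is an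
  eigenfunction, and it bounds all eigenvalues, since each is the Rayleigh quotient of its own
  eigenfunctions. Hence \<open>k\<close> is \<open>rho G\<close>.\<close>

lemma
  assumes G: "pair_graph G" and ne: "pverts G \<noteq> {}"
  shows adj_form_le_rho: "adj_form G g g \<le> rho G * (\<Sum>v \<in> pverts G. (g v)\<^sup>2)"
    and rho_eigenfunction: "\<exists>f. (\<exists>v \<in> pverts G. f v \<noteq> 0) \<and> (\<forall>v \<in> pverts G. adj_sum G f v = rho G * f v)"
    and eigenvalue_le_rho: "\<lbrakk>v \<in> pverts G; f v \<noteq> 0; \<And>v. v \<in> pverts G \<Longrightarrow> adj_sum G f v = l * f v\<rbrakk> \<Longrightarrow> l \<le> rho G"
proof -
  interpret pair_graph G by fact
  let ?V = "pverts G"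
  have fin: "finite ?V" by (rule pair_finite_verts)
  obtain f k where f: "(\<Sum>v \<in> ?V. (f v)\<^sup>2) = 1" "adj_form G f f = k"
    "\<And>g. adj_form G g g \<le> k * (\<Sum>v \<in> ?V. (g v)\<^sup>2)"
    using rayleigh_maximum_exists[OF G ne] by blast
  have ev: "adj_sum G f w = k * f w" if "w \<in> ?V" for w
    by (rule rayleigh_maximiser_eigenfunction[OF G f(3) _ that]) (simp add: f)
  have fne: "\<exists>v\<in>?V. f v \<noteq> 0"
  proof (rule ccontr)
    assume "\<not> (\<exists>v\<in>?V. f v \<noteq> 0)"
    hence "(\<Sum>v \<in> ?V. (f v)\<^sup>2) = 0" by simp
    thus False using f(1) by simp
  qed
  obtain vs where vs: "distinct vs" "set vs = ?V" using finite_distinct_list[OF fin] by auto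
  have spec: "l \<in> spectrum (adj_mat G vs) \<longleftrightarrow>
      (\<exists>f. (\<exists>v \<in> ?V. f v \<noteq> 0) \<and> (\<forall>v \<in> ?V. adj_sum G f v = l * f v))" for l
    unfolding spectrum_def mem_Collect_eq eigenvalue_adj_mat[OF vs] adj_sum_def by (rule refl)
  have finsp: "finite (spectrum (adj_mat G vs))"
    by (rule card_finite_spectrum(1)[of _ "length vs"]) (simp add: adj_mat_def)
  have le: "l \<le> k" if "l \<in> spectrum (adj_mat G vs)" for l
  proof -
    from that obtain g v where g: "v \<in> ?V" "g v \<noteq> 0" "\<And>v. v \<in> ?V \<Longrightarrow> adj_sum G g v = l * g v"
      unfolding spec by blast
    have "adj_form G g g = l * (\<Sum>v \<in> ?V. (g v)\<^sup>2)"
      by (simp add: adj_form_altdef[OF G] g(3) sum_distrib_left power2_eq_square mult_ac)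
    moreover have "(\<Sum>v \<in> ?V. (g v)\<^sup>2) > 0"
      using g fin by (intro sum_pos2[of _ v]) auto
    ultimately show ?thesis using f(3)[of g] by simp
  qed
  have kin: "k \<in> spectrum (adj_mat G vs)" unfolding spec using fne ev by blast
  have rho: "rho G = k" unfolding rho_eq[OF vs] using finsp kin le by (intro Max_eqI)
  show "adj_form G g g \<le> rho G * (\<Sum>v \<in> pverts G. (g v)\<^sup>2)" unfolding rho by (rule f(3))
  show "\<exists>f. (\<exists>v \<in> pverts G. f v \<noteq> 0) \<and> (\<forall>v \<in> pverts G. adj_sum G f v = rho G * f v)"
    unfolding rho using fne ev by blast
  show "l \<le> rho G" if "v \<in> pverts G" "f v \<noteq> 0" "\<And>v. v \<in> pverts G \<Longrightarrow> adj_sum G f v = l * f v" for l v and f :: "'a \<Rightarrow> real"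
    unfolding rho using that by (intro le) (auto simp: spec)
qed

text \<open>Perron-Frobenius argument: let \<open>g\<close> belong to \<open>rho G\<close> and pair
  \<open>f\<close> with its absolute value \<open>?a\<close>. The triangle inequality gives
  \<open>rho G * ?a v \<le> adj_sum G ?a v\<close>, symmetry moves the adjacency operator onto
  \<open>f\<close>, where it acts as \<open>l\<close>, and the pairing is positive.\<close>

lemma rho_eq_of_positive_eigenfunction:
  assumes G: "pair_graph G" and ne: "pverts G \<noteq> {}"
    and pos: "\<And>v. v \<in> pverts G \<Longrightarrow> f v > 0"
    and ev: "\<And>v. v \<in> pverts G \<Longrightarrow> adj_sum G f v = l * f v"
  shows "rho G = l"
proof (rule antisym)
  interpret pair_graph G by fact
  let ?V = "pverts G"
  have fin: "finite ?V" by (rule pair_finite_verts)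
  obtain w where "w \<in> ?V" using ne by auto
  thus "l \<le> rho G" using eigenvalue_le_rho[OF G ne, of w f l] pos[of w] ev by simp
  obtain g v where g: "v \<in> ?V" "g v \<noteq> 0" "\<And>v. v \<in> ?V \<Longrightarrow> adj_sum G g v = rho G * g v"
    using rho_eigenfunction[OF G ne] by blast
  let ?a = "\<lambda>v. \<bar>g v\<bar>"
  have le: "rho G * ?a v \<le> adj_sum G ?a v" if "v \<in> ?V" for v
  proof -
    have "rho G * ?a v \<le> \<bar>rho G * g v\<bar>" by (simp add: abs_mult mult_right_mono)
    also have "\<dots> \<le> adj_sum G ?a v"
      unfolding g(3)[OF that, symmetric] adj_sum_def by (rule sum_abs)
    finally show ?thesis .
  qed
  have "rho G * (\<Sum>v\<in>?V. f v * ?a v) = (\<Sum>v\<in>?V. f v * (rho G * ?a v))"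
    by (simp add: sum_distrib_left mult_ac)
  also have "\<dots> \<le> (\<Sum>v\<in>?V. f v * adj_sum G ?a v)"
    using le pos by (intro sum_mono mult_left_mono) (auto intro: less_imp_le)
  also have "\<dots> = adj_form G ?a f"
    by (simp add: adj_form_altdef[OF G, symmetric] adj_form_commute[OF G])
  also have "\<dots> = l * (\<Sum>v\<in>?V. f v * ?a v)"
    by (simp add: adj_form_altdef[OF G] ev sum_distrib_left mult_ac)
  finally have "rho G * (\<Sum>v\<in>?V. f v * ?a v) \<le> l * (\<Sum>v\<in>?V. f v * ?a v)" .
  moreover have "(\<Sum>v\<in>?V. f v * ?a v) > 0"
    using g(1,2) fin pos by (intro sum_pos2[of _ v]) (auto intro!: mult_pos_pos mult_nonneg_nonneg less_imp_le[OF pos])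
  ultimately show "rho G \<le> l" by simp
qed

section \<open>Invariance under isomorphism\<close>

text \<open>Composition with \<open>\<phi>\<close> turns an eigenfunction of \<open>H\<close> for
  \<open>rho H\<close> into one of \<open>G\<close> for the same eigenvalue.\<close>

lemma rho_le_of_bijection:
  assumes G: "pair_graph G" and H: "pair_graph H" and ne: "pverts G \<noteq> {}"
    and bij: "bij_betw \<phi> (pverts G) (pverts H)"
    and arcs: "\<And>u v. u \<in> pverts G \<Longrightarrow> v \<in> pverts G \<Longrightarrow> (u, v) \<in> parcs G \<longleftrightarrow> (\<phi> u, \<phi> v) \<in> parcs H"
  shows "rho H \<le> rho G"
proof -
  have neH: "pverts H \<noteq> {}" using bij ne by (auto simp: bij_betw_def)
  obtain f v where f: "v \<in> pverts H" "f v \<noteq> 0" "\<And>v. v \<in> pverts H \<Longrightarrow> adj_sum H f v = rho H * f v"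
    using rho_eigenfunction[OF H neH] by blast
  have "adj_sum G (f \<circ> \<phi>) u = rho H * (f \<circ> \<phi>) u" if u: "u \<in> pverts G" for u
  proof -
    have "bij_betw \<phi> {w \<in> pverts G. (u, w) \<in> parcs G} {w \<in> pverts H. (\<phi> u, w) \<in> parcs H}"
    proof (rule bij_betw_imageI)
      show "inj_on \<phi> {w \<in> pverts G. (u, w) \<in> parcs G}"
        using bij by (auto simp: bij_betw_def inj_on_def)
      have "pverts H = \<phi> ` pverts G" using bij by (simp add: bij_betw_def)
      thus "\<phi> ` {w \<in> pverts G. (u, w) \<in> parcs G} = {w \<in> pverts H. (\<phi> u, w) \<in> parcs H}"
        using arcs[OF u] by auto
    qed
    hence "adj_sum G (f \<circ> \<phi>) u = adj_sum H f (\<phi> u)"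
      unfolding adj_sum_def comp_def by (rule sum.reindex_bij_betw)
    also have "\<dots> = rho H * f (\<phi> u)" using bij u by (intro f) (auto simp: bij_betw_def)
    finally show ?thesis by simp
  qed
  moreover obtain u where "u \<in> pverts G" "\<phi> u = v"
    using f(1) bij by (metis bij_betw_imp_surj_on imageE)
  ultimately show ?thesis using f(2) by (intro eigenvalue_le_rho[OF G ne, of u "f \<circ> \<phi>"]) auto
qed

lemma rho_digraph_iso:
  assumes G: "pair_graph G" and H: "pair_graph H" and ne: "pverts G \<noteq> {}"
    and iso: "digraph_iso (with_proj G) (with_proj H)"
  shows "rho G = rho H"
proof -
  interpret G: pair_graph G by fact
  from iso obtain F where F: "pre_digraph.digraph_isomorphism (with_proj G) F"
    "with_proj H = app_iso F (with_proj G)" by (auto simp: digraph_iso_def)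
  define \<phi> where "\<phi> = iso_verts F"
  have inj: "inj_on \<phi> (pverts G)"
    using F(1) by (auto simp: pre_digraph.digraph_isomorphism_def \<phi>_def)
  have VH: "pverts H = \<phi> ` pverts G"
    using arg_cong[OF F(2), of verts] by (simp add: \<phi>_def)
  \<comment> \<open>Both digraphs have \<open>fst\<close> and \<open>snd\<close> as tail and head,
    so the vertex map of the isomorphism determines its arc map.\<close>
  have ht: "iso_tail F = fst" "iso_head F = snd"
    using arg_cong[OF F(2), of tail] arg_cong[OF F(2), of head] by simp_all
  have ia: "iso_arcs F e = (\<phi> (fst e), \<phi> (snd e))" if "e \<in> parcs G" for e
    using F(1) that by (auto simp: pre_digraph.digraph_isomorphism_def \<phi>_def ht prod_eq_iff)
  have "parcs H = iso_arcs F ` parcs G"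
    using arg_cong[OF F(2), of arcs] by simp
  hence AH: "parcs H = (\<lambda>e. (\<phi> (fst e), \<phi> (snd e))) ` parcs G" using ia by auto
  have arcs: "(u, v) \<in> parcs G \<longleftrightarrow> (\<phi> u, \<phi> v) \<in> parcs H" if "u \<in> pverts G" "v \<in> pverts G" for u v
  proof
    assume "(u, v) \<in> parcs G"
    thus "(\<phi> u, \<phi> v) \<in> parcs H" unfolding AH by force
  next
    assume "(\<phi> u, \<phi> v) \<in> parcs H"
    then obtain x y where "(x, y) \<in> parcs G" "\<phi> u = \<phi> x" "\<phi> v = \<phi> y" unfolding AH by auto
    moreover from this have "x \<in> pverts G" "y \<in> pverts G"
      using G.arc_fst_in_verts G.arc_snd_in_verts by force+
    ultimately show "(u, v) \<in> parcs G" using inj that by (auto dest: inj_onD)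
  qed
  have bij: "bij_betw \<phi> (pverts G) (pverts H)" using inj VH by (simp add: bij_betw_def)
  let ?\<psi> = "the_inv_into (pverts G) \<phi>"
  have bij': "bij_betw ?\<psi> (pverts H) (pverts G)" using bij by (rule bij_betw_the_inv_into)
  show ?thesis
  proof (rule antisym)
    show "rho H \<le> rho G" by (rule rho_le_of_bijection[OF G H ne bij arcs])
    show "rho G \<le> rho H"
    proof (rule rho_le_of_bijection[OF H G _ bij'])
      show "pverts H \<noteq> {}" using VH ne by simp
      show "(u, v) \<in> parcs H \<longleftrightarrow> (?\<psi> u, ?\<psi> v) \<in> parcs G" if "u \<in> pverts H" "v \<in> pverts H" for u v
      proof -
        have "\<phi> (?\<psi> w) = w" "?\<psi> w \<in> pverts G" if "w \<in> pverts H" for w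
          using that bij bij' by (simp_all add: f_the_inv_into_f_bij_betw bij_betwE)
        thus ?thesis using arcs[of "?\<psi> u" "?\<psi> v"] that by simp
      qed
    qed
  qed
qed

lemma digraph_isoI:
  assumes G: "pair_graph G" and inj: "inj_on \<phi> (pverts G)"
    and V: "pverts H = \<phi> ` pverts G" and A: "parcs H = map_prod \<phi> \<phi> ` parcs G"
  shows "digraph_iso (with_proj G) (with_proj H)"
proof -
  interpret pair_graph G by fact
  define F where "F = \<lparr> iso_verts = \<phi>, iso_arcs = map_prod \<phi> \<phi>, iso_head = snd, iso_tail = fst \<rparr>"
  have "inj_on (map_prod \<phi> \<phi>) (parcs G)"
    by (rule inj_on_subset[OF map_prod_inj_on[OF inj inj]])
       (use arc_fst_in_verts arc_snd_in_verts in force)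
  hence "pre_digraph.digraph_isomorphism (with_proj G) F"
    using inj by (auto simp: pre_digraph.digraph_isomorphism_def F_def wf_digraph_axioms)
  moreover have "with_proj H = app_iso F (with_proj G)"
    by (simp add: app_iso_def F_def with_proj_def V A)
  ultimately show ?thesis unfolding digraph_iso_def by blast
qed

section \<open>Comparison with subgraphs and the degree bound\<close>

text \<open>\<open>E\<close> holds one orientation of each edge of a subgraph, hence the factor 2.
  All other arcs contribute nonnegative terms, and positive ones if \<open>f\<close> is
  positive.\<close>

lemma adj_form_ge_edges:
  assumes G: "pair_graph G" and nn: "\<And>v. v \<in> pverts G \<Longrightarrow> f v \<ge> 0"
    and E: "E \<subseteq> parcs G" and asym: "E \<inter> E\<inverse> = {}"
  shows "2 * (\<Sum>(u, v) \<in> E. f u * f v) \<le> adj_form G f f"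
    and "\<lbrakk>\<And>v. v \<in> pverts G \<Longrightarrow> f v > 0; \<not> parcs G \<subseteq> E \<union> E\<inverse>\<rbrakk> \<Longrightarrow>
           2 * (\<Sum>(u, v) \<in> E. f u * f v) < adj_form G f f"
proof -
  interpret pair_graph G by fact
  have fin: "finite (parcs G)" by (rule pair_finite_arcs)
  have finE: "finite E" using finite_subset[OF E fin] .
  have sub: "E \<union> E\<inverse> \<subseteq> parcs G" using E arcs_sym[OF G] by auto
  have swap: "(\<Sum>(u, v) \<in> E\<inverse>. f u * f v) = (\<Sum>(u, v) \<in> E. f u * f v)"
    by (rule sum.reindex_bij_witness[of _ prod.swap prod.swap]) (auto simp: mult.commute)
  have "(\<Sum>(u, v) \<in> E \<union> E\<inverse>. f u * f v) = (\<Sum>(u, v) \<in> E. f u * f v) + (\<Sum>(u, v) \<in> E\<inverse>. f u * f v)"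
    by (rule sum.union_disjoint) (use finE asym in auto)
  hence eq: "(\<Sum>(u, v) \<in> E \<union> E\<inverse>. f u * f v) = 2 * (\<Sum>(u, v) \<in> E. f u * f v)"
    unfolding swap by simp
  have ends: "u \<in> pverts G" "v \<in> pverts G" if "(u, v) \<in> parcs G" for u v
    using arc_fst_in_verts[OF that] arc_snd_in_verts[OF that] by auto
  show "2 * (\<Sum>(u, v) \<in> E. f u * f v) \<le> adj_form G f f"
    unfolding eq[symmetric] adj_form_def using fin sub
    by (rule sum_mono2) (use ends nn in auto)
  assume pos: "\<And>v. v \<in> pverts G \<Longrightarrow> f v > 0" and "\<not> parcs G \<subseteq> E \<union> E\<inverse>"
  then obtain x y where xy: "(x, y) \<in> parcs G - (E \<union> E\<inverse>)" by auto
  show "2 * (\<Sum>(u, v) \<in> E. f u * f v) < adj_form G f f"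
    unfolding eq[symmetric] adj_form_def using fin sub xy
    by (rule sum_strict_mono2) (use xy ends pos in \<open>auto simp: less_imp_le\<close>)
qed

lemma connected_crossing_arc:
  assumes G: "pair_graph G" and con: "Digraph_Component.connected (with_proj G)"
    and S: "S \<subseteq> pverts G" "S \<noteq> {}" "S \<noteq> pverts G"
  obtains x y where "x \<in> S" "y \<in> pverts G - S" "(x, y) \<in> parcs G"
proof -
  interpret pair_graph G by fact
  obtain u v where uv: "u \<in> S" "v \<in> pverts G" "v \<notin> S" using S by auto
  have "(u, v) \<in> rtrancl_on (pverts G) ((parcs G)\<^sup>s)"
    using con uv S(1) by (auto simp: connected_conv)
  hence "v \<in> S \<or> (\<exists>x\<in>S. \<exists>y\<in>pverts G - S. (x, y) \<in> parcs G)"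
  proof (induction rule: rtrancl_on_induct)
    case base
    then show ?case using uv by simp
  next
    case (step x y)
    have "(x, y) \<in> parcs G" using step(2) arcs_sym[OF G] by (auto simp: symcl_def)
    thus ?case using step by auto
  qed
  thus ?thesis using uv that by blast
qed

text \<open>A star with \<open>d\<close> edges has spectral radius \<open>sqrt d\<close>. The star
  of \<open>c\<close> and its neighbours misses \<open>w\<close>, and in a connected graph a proper
  subgraph has a strictly smaller spectral radius.\<close>

lemma degree_less_rho_bound:
  assumes G: "pair_graph G" and con: "Digraph_Component.connected (with_proj G)"
    and c: "c \<in> pverts G" and l: "rho G \<le> l" "l > 0"
    and w: "w \<in> pverts G" "w \<noteq> c" "(c, w) \<notin> parcs G"
  shows "real (card {u \<in> pverts G. (c, u) \<in> parcs G}) < l\<^sup>2"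
proof (rule ccontr)
  interpret pair_graph G by fact
  let ?V = "pverts G" and ?N = "{u \<in> pverts G. (c, u) \<in> parcs G}"
  assume "\<not> ?thesis"
  hence deg: "l\<^sup>2 \<le> real (card ?N)" by simp
  have fin: "finite ?V" by (rule pair_finite_verts)
  have cN: "c \<notin> ?N" using pair_no_loops[of "(c, c)"] by auto
  \<comment> \<open>The Perron vector of the star in the case that \<open>l\<^sup>2\<close> is the
    degree. If the degree is at least \<open>l\<^sup>2\<close>, the Rayleigh quotient of
    \<open>f\<close> is at least \<open>l\<close>, so \<open>f\<close> is a maximiser.\<close>
  define f where "f v = (if v = c then l else of_bool (v \<in> ?N))" for v
  have f1: "f v = 1" if "v \<in> ?N" for v using that cN by (auto simp: f_def)
  have nn: "f v \<ge> 0" for v using l by (simp add: f_def)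
  let ?E = "Pair c ` ?N"
  have "(\<Sum>(u, v)\<in>?E. f u * f v) = (\<Sum>v\<in>?N. f c * f v)"
    by (subst sum.reindex) (auto simp: inj_on_def)
  also have "\<dots> = l * card ?N" using f1 by (simp add: f_def[of c])
  finally have "2 * (l * card ?N) \<le> adj_form G f f"
    using adj_form_ge_edges(1)[where f = f and E = ?E, OF G nn] cN by auto
  moreover have "(\<Sum>v\<in>?V. (f v)\<^sup>2) = l\<^sup>2 + card ?N"
  proof -
    have "(\<Sum>v\<in>?V. (f v)\<^sup>2) = (\<Sum>v\<in>insert c ?N. (f v)\<^sup>2)"
      using fin c by (intro sum.mono_neutral_right) (auto simp: f_def)
    also have "\<dots> = l\<^sup>2 + (\<Sum>v\<in>?N. (f v)\<^sup>2)"
      using fin cN by (subst sum.insert) (simp_all add: f_def[of c])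
    also have "(\<Sum>v\<in>?N. (f v)\<^sup>2) = card ?N" using f1 by simp
    finally show ?thesis .
  qed
  moreover have "l * (l\<^sup>2 + card ?N) \<le> l * (2 * card ?N)"
    using deg l(2) by (intro mult_left_mono) auto
  moreover have "rho G * (\<Sum>v\<in>?V. (f v)\<^sup>2) \<le> l * (\<Sum>v\<in>?V. (f v)\<^sup>2)"
    using l by (intro mult_right_mono) (auto intro: sum_nonneg)
  ultimately have "adj_form G f f \<ge> rho G * (\<Sum>v\<in>?V. (f v)\<^sup>2)"
    by (simp add: algebra_simps)
  moreover have ne: "?V \<noteq> {}" using c by auto
  ultimately have eq: "adj_form G f f = rho G * (\<Sum>v\<in>?V. (f v)\<^sup>2)"
    using adj_form_le_rho[OF G ne, of f] by linarith
  \<comment> \<open>The eigenvalue equation fails at \<open>y\<close>: there \<open>f\<close>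
    vanishes although the neighbour \<open>x\<close> has a positive value.\<close>
  obtain x y where xy: "x \<in> insert c ?N" "y \<in> ?V - insert c ?N" "(x, y) \<in> parcs G"
    by (rule connected_crossing_arc[OF G con, of "insert c ?N"]) (use c w in auto)
  have "adj_sum G f y = rho G * f y"
    by (rule rayleigh_maximiser_eigenfunction[OF G adj_form_le_rho[OF G ne] eq]) (use xy in auto)
  moreover have "f y = 0" using xy by (auto simp: f_def)
  moreover have "adj_sum G f y > 0"
    unfolding adj_sum_def using fin xy arcs_sym[OF G xy(3)] c nn l
    by (intro sum_pos2[of _ x]) (auto simp: f_def)
  ultimately show False by simp
qed

section \<open>Three linked stars\<close>

text \<open>
  \<open>link_energy p l x y\<close> is \<open>l\<close> times what a link of length \<open>p\<close> between centres with values \<open>x\<close>, \<open>y\<close>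
  contributes to the quadratic form \<open>A - l I\<close> after maximising over the inner vertices of the link,
  compared with one pendent edge at each end of the link instead.
\<close>

definition link_energy :: "nat \<Rightarrow> real \<Rightarrow> real \<Rightarrow> real \<Rightarrow> real" where
  "link_energy p l x y =
     (if p = 1 then 2 * l * x * y - x\<^sup>2 - y\<^sup>2 else if p = 2 then 2 * x * y
      else (x\<^sup>2 + y\<^sup>2 + 2 * l * x * y) / (l\<^sup>2 - 1))"

text \<open>\<open>\<alpha>\<close> and \<open>\<beta>\<close> say whether the two ends of the link
  are centres, and \<open>u\<close>, \<open>v\<close> are the values at the ends; an end that is a
  leaf satisfies its eigenvalue equation. The squares belonging to central ends later turn leaf
  counts into degrees.\<close>

lemma link_values:
  fixes l x y :: real
  assumes l: "l > 1" and xy: "x \<ge> 0" "y \<ge> 0"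
  obtains u v where "u \<ge> 0" "v \<ge> 0" "\<alpha> \<Longrightarrow> u = x" "\<not> \<alpha> \<Longrightarrow> l * u = x + v" "\<beta> \<Longrightarrow> v = y" "\<not> \<beta> \<Longrightarrow> l * v = y + u"
    "2 * l * u * v - of_bool (\<not> \<alpha>) * v\<^sup>2 - of_bool (\<not> \<beta>) * u\<^sup>2 =
       link_energy (3 - of_bool \<alpha> - of_bool \<beta>) l x y + of_bool \<alpha> * x\<^sup>2 + of_bool \<beta> * y\<^sup>2"
    "x > 0 \<Longrightarrow> y > 0 \<Longrightarrow> u > 0 \<and> v > 0"
proof (cases \<alpha>; cases \<beta>)
  assume "\<alpha>" "\<beta>"
  thus ?thesis using xy by (intro that[of x y]) (auto simp: link_energy_def)
next
  assume "\<alpha>" "\<not> \<beta>"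
  thus ?thesis using xy l
    by (intro that[of x "(x + y) / l"]) (auto simp: link_energy_def field_simps power2_eq_square)
next
  assume "\<not> \<alpha>" "\<beta>"
  thus ?thesis using xy l
    by (intro that[of "(x + y) / l" y]) (auto simp: link_energy_def field_simps power2_eq_square)
next
  assume ab: "\<not> \<alpha>" "\<not> \<beta>"
  \<comment> \<open>The solution of \<open>l * u = x + v\<close>, \<open>l * v = y + u\<close>, a
    system with determinant \<open>l\<^sup>2 - 1\<close>.\<close>
  define u v where "u = (l * x + y) / (l\<^sup>2 - 1)" and "v = (x + l * y) / (l\<^sup>2 - 1)"
  have q: "l\<^sup>2 - 1 > 0" using l by (simp add: one_less_power)
  have uv: "u \<ge> 0" "v \<ge> 0" "l * u = x + v" "l * v = y + u"
    unfolding u_def v_def using q xy l by (auto simp: field_simps power2_eq_square)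
  have pos: "x > 0 \<Longrightarrow> y > 0 \<Longrightarrow> u > 0 \<and> v > 0"
    unfolding u_def v_def using q l by (auto intro!: divide_pos_pos add_pos_pos mult_pos_pos)
  have "2 * l * u * v - v\<^sup>2 - u\<^sup>2 = (l * u) * v + (l * v) * u - v\<^sup>2 - u\<^sup>2" by simp
  also have "\<dots> = u * y + v * x"
    unfolding uv by (simp add: algebra_simps power2_eq_square)
  also have "\<dots> = (x\<^sup>2 + y\<^sup>2 + 2 * l * x * y) / (l\<^sup>2 - 1)"
    unfolding u_def v_def
    by (simp add: add_divide_distrib[symmetric] algebra_simps power2_eq_square)
  finally show ?thesis using ab uv pos by (intro that[of u v]) (auto simp: link_energy_def)
qed

text \<open>\<open>h\<close> sends each vertex to the centre of its star. Link ends may be centres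
  or leaves, and \<open>b = b'\<close> is possible, since connectivity says nothing about where the
  links leave the middle star.\<close>

locale three_stars =
  fixes G :: "'a pair_pre_digraph" and c1 c2 c3 :: 'a and h :: "'a \<Rightarrow> 'a" and a b b' c :: 'a
  assumes G: "pair_graph G"
    and centres: "c1 \<in> pverts G" "c2 \<in> pverts G" "c3 \<in> pverts G" "c1 \<noteq> c2" "c1 \<noteq> c3" "c2 \<noteq> c3"
    and h_centres [simp]: "h c1 = c1" "h c2 = c2" "h c3 = c3"
    and h_leaf: "\<And>v. v \<in> pverts G - {c1, c2, c3} \<Longrightarrow> h v \<in> {c1, c2, c3} \<and> (v, h v) \<in> parcs G"
    and link: "(a, b) \<in> parcs G" "(b', c) \<in> parcs G"
    and h_link [simp]: "h a = c1" "h b = c2" "h b' = c2" "h c = c3"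
begin

abbreviation "C \<equiv> {c1, c2, c3}"
abbreviation "W \<equiv> pverts G - C"

definition leaves :: "'a \<Rightarrow> 'a set" where "leaves x = {v \<in> W. h v = x}"

text \<open>One arc for each edge of the spanning tree, with leaves pointing to their centres: the
  form that \<open>adj_form_ge_edges\<close> expects.\<close>

definition edges :: "'a rel" where "edges = (\<lambda>v. (v, h v)) ` W \<union> {(a, b), (b', c)}"

lemma finite_verts: "finite (pverts G)"
proof -
  interpret pair_graph G by (rule G)
  show ?thesis by (rule pair_finite_verts)
qed

lemma ends: "(u, v) \<in> parcs G \<Longrightarrow> u \<in> pverts G" "(u, v) \<in> parcs G \<Longrightarrow> v \<in> pverts G"
proof -
  interpret pair_graph G by (rule G)
  show "(u, v) \<in> parcs G \<Longrightarrow> u \<in> pverts G" "(u, v) \<in> parcs G \<Longrightarrow> v \<in> pverts G"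
    using arc_fst_in_verts arc_snd_in_verts by force+
qed

lemma link_verts: "a \<in> pverts G" "b \<in> pverts G" "b' \<in> pverts G" "c \<in> pverts G"
  using link ends by blast+

lemma link_distinct: "a \<noteq> b" "a \<noteq> b'" "a \<noteq> c" "b \<noteq> c" "b' \<noteq> c"
  using h_link centres by metis+

lemma link_centre: "a \<in> C \<longleftrightarrow> a = c1" "b \<in> C \<longleftrightarrow> b = c2" "b' \<in> C \<longleftrightarrow> b' = c2" "c \<in> C \<longleftrightarrow> c = c3"
  using h_link h_centres centres by (metis insertCI insertE singletonD)+

lemma h_idem: "v \<in> pverts G \<Longrightarrow> h (h v) = h v"
  using h_leaf[of v] h_centres by (metis DiffI insert_iff singletonD)

lemma sum_leaves:
  fixes F :: "'a \<Rightarrow> real"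
  shows "(\<Sum>v\<in>W. F (h v)) = card (leaves c1) * F c1 + card (leaves c2) * F c2 + card (leaves c3) * F c3"
proof -
  have "(\<Sum>v\<in>W. F (h v)) = (\<Sum>x\<in>C. \<Sum>v\<in>leaves x. F (h v))"
    unfolding leaves_def by (rule sum.group[symmetric]) (use finite_verts h_leaf in auto)
  also have "\<dots> = (\<Sum>x\<in>C. card (leaves x) * F x)"
    by (intro sum.cong refl) (simp add: leaves_def)
  also have "\<dots> = card (leaves c1) * F c1 + card (leaves c2) * F c2 + card (leaves c3) * F c3"
    using centres by simp
  finally show ?thesis .
qed

lemma card_verts: "card (pverts G) = 3 + card (leaves c1) + card (leaves c2) + card (leaves c3)"
proof -
  have "real (card W) = card (leaves c1) + card (leaves c2) + card (leaves c3)"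
    using sum_leaves[of "\<lambda>_. 1"] by simp
  moreover have "card (pverts G) = card W + card C"
  proof -
    have "card (W \<union> C) = card W + card C"
      using finite_verts by (intro card_Un_disjoint) auto
    moreover have "W \<union> C = pverts G" using centres by auto
    ultimately show ?thesis by (simp only:)
  qed
  moreover have "card C = 3" using centres by simp
  ultimately show ?thesis by linarith
qed

lemma edges_subset: "edges \<subseteq> parcs G"
  using h_leaf link by (auto simp: edges_def)

lemma edges_asym: "edges \<inter> edges\<inverse> = {}"
proof -
  have *: False if "(x, y) \<in> edges" "(y, x) \<in> edges" for x y
  \<comment> \<open>Star edges stay inside a class of \<open>h\<close> and links join different
    classes. So an arc and its reverse would both be star arcs, whose tails are leaves but not their
    heads, or both be links.\<close>
  proof (cases "h x = h y")
    case True
    hence "(x, y) \<notin> {(a, b), (b', c)}" "(y, x) \<notin> {(a, b), (b', c)}"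
      using centres by (metis Pair_inject h_link insertE singletonD)+
    hence "(x, y) \<in> (\<lambda>v. (v, h v)) ` W" "(y, x) \<in> (\<lambda>v. (v, h v)) ` W"
      using that unfolding edges_def by (metis Un_iff)+
    hence "x \<in> W" "y = h x" "y \<in> W" by auto
    thus False using h_leaf[of x] by blast
  next
    case False
    have "h x = h y" if "(x, y) \<in> (\<lambda>v. (v, h v)) ` W" for x y using that h_idem by auto
    hence "(x, y) \<in> {(a, b), (b', c)}" "(y, x) \<in> {(a, b), (b', c)}"
      using that False unfolding edges_def by (metis Un_iff)+
    thus False using centres link_distinct by auto
  qed
  thus ?thesis by auto
qed

lemma sum_edges:
  fixes f :: "'a \<Rightarrow> real"
  shows "(\<Sum>(u, v)\<in>edges. f u * f v) = (\<Sum>v\<in>W. f v * f (h v)) + f a * f b + f b' * f c"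
proof -
  have "(\<lambda>v. (v, h v)) ` W \<inter> {(a, b), (b', c)} = {}"
    using h_idem centres by (auto; metis h_link)
  hence "(\<Sum>(u, v)\<in>edges. f u * f v) =
      (\<Sum>(u, v)\<in>(\<lambda>v. (v, h v)) ` W. f u * f v) + (\<Sum>(u, v)\<in>{(a, b), (b', c)}. f u * f v)"
    unfolding edges_def using finite_verts by (intro sum.union_disjoint) auto
  also have "(\<Sum>(u, v)\<in>(\<lambda>v. (v, h v)) ` W. f u * f v) = (\<Sum>v\<in>W. f v * f (h v))"
    by (subst sum.reindex) (auto simp: inj_on_def)
  also have "(\<Sum>(u, v)\<in>{(a, b), (b', c)}. f u * f v) = f a * f b + f b' * f c"
    using link_distinct by simp
  finally show ?thesis by simp
qed

text \<open>
  The leaf values are additive over the links, so if both links end in the same leaf \<open>b = b'\<close> of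
  the middle star, the quadratic form only grows, by the term with factor \<open>\<tau>\<close>. Hence that
  configuration needs no separate analysis.
\<close>

lemma test_inequality:
  fixes X :: "'a \<Rightarrow> real" and l ga gb gb' gc :: real
  defines "\<tau> \<equiv> of_bool (b = b' \<and> b \<noteq> c2)"
  assumes rho: "rho G \<le> l" and l: "l > 0"
    and X: "X c1 \<ge> 0" "X c2 \<ge> 0" "X c3 \<ge> 0"
    and g: "ga \<ge> 0" "gb \<ge> 0" "gb' \<ge> 0" "gc \<ge> 0"
    and ga: "a = c1 \<Longrightarrow> ga = X c1" "a \<noteq> c1 \<Longrightarrow> l * ga = X c1 + gb"
    and gb: "b = c2 \<Longrightarrow> gb = X c2" "b \<noteq> c2 \<Longrightarrow> l * gb = X c2 + ga"
    and gb': "b' = c2 \<Longrightarrow> gb' = X c2" "b' \<noteq> c2 \<Longrightarrow> l * gb' = X c2 + gc"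
    and gc: "c = c3 \<Longrightarrow> gc = X c3" "c \<noteq> c3 \<Longrightarrow> l * gc = X c3 + gb'"
  defines "L \<equiv> 2 * l * ga * gb - of_bool (a \<noteq> c1) * gb\<^sup>2 - of_bool (b \<noteq> c2) * ga\<^sup>2
     + 2 * l * gb' * gc - of_bool (b' \<noteq> c2) * gc\<^sup>2 - of_bool (c \<noteq> c3) * gb'\<^sup>2 + 2 * \<tau> * ga * gc"
    and "R \<equiv> (l\<^sup>2 - card (leaves c1)) * (X c1)\<^sup>2 + (l\<^sup>2 - card (leaves c2)) * (X c2)\<^sup>2 + (l\<^sup>2 - card (leaves c3)) * (X c3)\<^sup>2"
  shows "L \<le> R"
    and "\<lbrakk>X c1 > 0; X c2 > 0; X c3 > 0; \<not> parcs G \<subseteq> edges \<union> edges\<inverse>\<rbrakk> \<Longrightarrow> L < R"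
proof -
  let ?V = "pverts G"
  \<comment> \<open>\<open>A w t\<close> is the share \<open>t / l\<close> that a neighbour with
    value \<open>t\<close> adds at the link end \<open>w\<close>. With these shares \<open>f\<close>
    takes the values \<open>ga\<close>, \<open>gb\<close>, \<open>gb'\<close>, \<open>gc\<close> at
    the link ends, except that a shared leaf \<open>b = b'\<close> collects two shares.\<close>
  define A :: "'a \<Rightarrow> real \<Rightarrow> 'a \<Rightarrow> real" where "A w t v = of_bool (v = w) * t / l" for w t v
  define z where "z v = A a gb v + A b ga v + A b' gc v + A c gb' v" for v
  define f where "f v = (if v \<in> C then X v else X (h v) / l + z v)" for v
  have z0: "z v \<ge> 0" for v using g l by (auto simp: z_def A_def)
  have Xh: "X (h v) \<ge> 0" if "v \<in> ?V" for v using that X h_leaf[of v] by (cases "v \<in> C") auto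
  have nn: "f v \<ge> 0" if "v \<in> ?V" for v
    using Xh[OF that] z0[of v] l X by (auto simp: f_def)
  have fa: "f a = ga"
    using ga l link_centre link_distinct by (cases "a = c1") (auto simp: f_def z_def A_def field_simps)
  have fc: "f c = gc"
    using gc l link_centre link_distinct by (cases "c = c3") (auto simp: f_def z_def A_def field_simps)
  have fb: "f b = gb + \<tau> * gc / l"
    using gb l link_centre link_distinct
    by (cases "b = c2") (auto simp: f_def z_def A_def field_simps \<tau>_def)
  have fb': "f b' = gb' + \<tau> * ga / l"
    using gb' l link_centre link_distinct
    by (cases "b' = c2") (auto simp: f_def z_def A_def field_simps \<tau>_def)
  have Aw: "(\<Sum>v\<in>W. A w t v * A w' t' v) = of_bool (w = w' \<and> w \<notin> C) * (t * t') / l\<^sup>2"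
    if "w \<in> ?V" for w t w' t'
  proof -
    have "(\<Sum>v\<in>W. A w t v * A w' t' v) = (\<Sum>v\<in>W. if v = w then A w t w * A w' t' w else 0)"
      by (intro sum.cong) (auto simp: A_def)
    also have "\<dots> = (if w \<in> W then A w t w * A w' t' w else 0)" using finite_verts by (simp add: sum.delta)
    finally show ?thesis using that by (auto simp: A_def power2_eq_square)
  qed
  \<comment> \<open>Cross terms of different ends vanish. Among the four ends only \<open>b\<close>
    and \<open>b'\<close> can coincide, which gives the term with \<open>\<tau>\<close>.\<close>
  have zz: "l\<^sup>2 * (\<Sum>v\<in>W. (z v)\<^sup>2) = of_bool (a \<noteq> c1) * gb\<^sup>2 + of_bool (b \<noteq> c2) * ga\<^sup>2
     + of_bool (b' \<noteq> c2) * gc\<^sup>2 + of_bool (c \<noteq> c3) * gb'\<^sup>2 + 2 * \<tau> * ga * gc"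
  proof -
    have "(\<Sum>v\<in>W. (z v)\<^sup>2) = (\<Sum>v\<in>W. A a gb v * A a gb v) + (\<Sum>v\<in>W. A b ga v * A b ga v)
        + (\<Sum>v\<in>W. A b' gc v * A b' gc v) + (\<Sum>v\<in>W. A c gb' v * A c gb' v)
        + 2 * (\<Sum>v\<in>W. A a gb v * A b ga v) + 2 * (\<Sum>v\<in>W. A a gb v * A b' gc v) + 2 * (\<Sum>v\<in>W. A a gb v * A c gb' v)
        + 2 * (\<Sum>v\<in>W. A b ga v * A b' gc v) + 2 * (\<Sum>v\<in>W. A b ga v * A c gb' v) + 2 * (\<Sum>v\<in>W. A b' gc v * A c gb' v)"
      unfolding z_def by (simp add: sum.distrib sum_distrib_left algebra_simps power2_eq_square)
    also have "\<dots> = (of_bool (a \<noteq> c1) * gb\<^sup>2 + of_bool (b \<noteq> c2) * ga\<^sup>2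
     + of_bool (b' \<noteq> c2) * gc\<^sup>2 + of_bool (c \<noteq> c3) * gb'\<^sup>2 + 2 * \<tau> * ga * gc) / l\<^sup>2"
      using link_verts link_distinct link_centre
      by (simp add: Aw add_divide_distrib \<tau>_def power2_eq_square)
    finally show ?thesis using l by simp
  qed
  have "(\<Sum>v\<in>?V. (f v)\<^sup>2) = (\<Sum>v\<in>C. (X v)\<^sup>2) + (\<Sum>v\<in>W. (X (h v) / l + z v)\<^sup>2)"
  proof -
    have "(\<Sum>v\<in>?V. (f v)\<^sup>2) = (\<Sum>v\<in>W. (f v)\<^sup>2) + (\<Sum>v\<in>C. (f v)\<^sup>2)"
      using centres finite_verts by (intro sum.subset_diff) auto
    thus ?thesis by (simp add: f_def)
  qed
  moreover have "(\<Sum>v\<in>C. (X v)\<^sup>2) = (X c1)\<^sup>2 + (X c2)\<^sup>2 + (X c3)\<^sup>2" using centres by simp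
  moreover have "(\<Sum>v\<in>W. f v * f (h v)) = (\<Sum>v\<in>W. (X (h v) / l + z v) * X (h v))"
    using h_leaf by (intro sum.cong) (auto simp: f_def)
  ultimately have "l * (\<Sum>v\<in>?V. (f v)\<^sup>2) - 2 * (\<Sum>v\<in>W. f v * f (h v)) =
      l * ((X c1)\<^sup>2 + (X c2)\<^sup>2 + (X c3)\<^sup>2) +
      (\<Sum>v\<in>W. l * (X (h v) / l + z v)\<^sup>2 - 2 * (X (h v) / l + z v) * X (h v))"
    by (simp add: sum_distrib_left sum_subtractf algebra_simps)
  \<comment> \<open>Completing the square at each leaf. Summed over a star, the terms
    \<open>- (X (h v))\<^sup>2 / l\<close> produce the leaf count in \<open>R\<close>.\<close>
  also have "(\<Sum>v\<in>W. l * (X (h v) / l + z v)\<^sup>2 - 2 * (X (h v) / l + z v) * X (h v)) =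
      (\<Sum>v\<in>W. l * (z v)\<^sup>2 - (X (h v))\<^sup>2 / l)"
    using l by (intro sum.cong) (auto simp: field_simps power2_eq_square)
  also have "\<dots> = l * (\<Sum>v\<in>W. (z v)\<^sup>2) - (\<Sum>v\<in>W. (X (h v))\<^sup>2) / l"
    by (simp add: sum_subtractf sum_distrib_left sum_divide_distrib)
  finally have "l * (l * (\<Sum>v\<in>?V. (f v)\<^sup>2) - 2 * (\<Sum>v\<in>W. f v * f (h v))) =
      l\<^sup>2 * ((X c1)\<^sup>2 + (X c2)\<^sup>2 + (X c3)\<^sup>2) + l\<^sup>2 * (\<Sum>v\<in>W. (z v)\<^sup>2) - (\<Sum>v\<in>W. (X (h v))\<^sup>2)"
    using l by (simp add: field_simps power2_eq_square)
  also have "\<dots> = R + l\<^sup>2 * (\<Sum>v\<in>W. (z v)\<^sup>2)"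
    unfolding R_def sum_leaves[of "\<lambda>x. (X x)\<^sup>2"] by (simp add: algebra_simps)
  finally have 1: "l * (l * (\<Sum>v\<in>?V. (f v)\<^sup>2) - 2 * (\<Sum>v\<in>W. f v * f (h v))) = R + l\<^sup>2 * (\<Sum>v\<in>W. (z v)\<^sup>2)" .
  \<comment> \<open>A shared leaf gains \<open>4 * \<tau> * ga * gc\<close> here and costs
    \<open>2 * \<tau> * ga * gc\<close> in \<open>zz\<close>; the surplus is the last term of
    \<open>L\<close>.\<close>
  have 2: "l * (2 * (f a * f b + f b' * f c)) = 2 * l * ga * gb + 2 * l * gb' * gc + 4 * \<tau> * ga * gc"
    unfolding fa fb fb' fc using l by (simp add: field_simps)
  have 3: "R - L = l * (l * (\<Sum>v\<in>?V. (f v)\<^sup>2) - 2 * (\<Sum>(u, v)\<in>edges. f u * f v))"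
    using 1 2 unfolding zz sum_edges L_def by (simp add: algebra_simps)
  have ne: "?V \<noteq> {}" using centres by auto
  have "rho G * (\<Sum>v\<in>?V. (f v)\<^sup>2) \<le> l * (\<Sum>v\<in>?V. (f v)\<^sup>2)"
    using rho by (intro mult_right_mono) (auto intro: sum_nonneg)
  hence 4: "adj_form G f f \<le> l * (\<Sum>v\<in>?V. (f v)\<^sup>2)"
    using adj_form_le_rho[OF G ne, of f] by linarith
  have "R - L \<ge> 0" unfolding 3
    using 4 adj_form_ge_edges(1)[where f = f, OF G nn edges_subset edges_asym] l by (intro mult_nonneg_nonneg) auto
  thus "L \<le> R" by simp
  assume pos: "X c1 > 0" "X c2 > 0" "X c3 > 0" and np: "\<not> parcs G \<subseteq> edges \<union> edges\<inverse>"
  have fpos: "f v > 0" if "v \<in> ?V" for v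
  proof (cases "v \<in> C")
    case False
    hence "X (h v) > 0" using pos h_leaf[of v] that by auto
    thus ?thesis using False z0[of v] l by (auto simp: f_def intro!: add_pos_nonneg)
  qed (use pos in \<open>auto simp: f_def\<close>)
  have "R - L > 0" unfolding 3
    using 4 adj_form_ge_edges(2)[where f = f, OF G nn edges_subset edges_asym fpos np] l by (intro mult_pos_pos) auto
  thus "L < R" by simp
qed

text \<open>
  \<open>D1, D2, D3\<close> are the degrees of the centres in the spanning tree, \<open>p\<close> and \<open>r\<close> the lengths of the
  links. With \<open>p = 3\<close> both ends of the first link are leaves, with \<open>p = 1\<close> both are centres.
\<close>

definition "D1 = card (leaves c1) + of_bool (a = c1)"
definition "D2 = card (leaves c2) + of_bool (b = c2) + of_bool (b' = c2)"
definition "D3 = card (leaves c3) + of_bool (c = c3)"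
definition "p = (3 - of_bool (a = c1) - of_bool (b = c2) :: nat)"
definition "r = (3 - of_bool (b' = c2) - of_bool (c = c3) :: nat)"

lemma sum_degrees: "D1 + D2 + D3 + p + r = card (pverts G) + 3"
  unfolding D1_def D2_def D3_def p_def r_def card_verts by simp

lemma lengths: "p \<in> {1, 2, 3}" "r \<in> {1, 2, 3}"
  by (auto simp: p_def r_def)

lemma leaves_nbs: "leaves x \<subseteq> {u \<in> pverts G. (x, u) \<in> parcs G}"
  using h_leaf arcs_sym[OF G] by (auto simp: leaves_def)

text \<open>In the tree a centre is adjacent to its leaves and, when it is itself an end of a link,
  to the opposite end.\<close>

lemma degree_ge:
  shows "D1 \<le> card {u \<in> pverts G. (c1, u) \<in> parcs G}"
    and "D2 \<le> card {u \<in> pverts G. (c2, u) \<in> parcs G}"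
    and "D3 \<le> card {u \<in> pverts G. (c3, u) \<in> parcs G}"
proof -
  let ?N = "\<lambda>x. {u \<in> pverts G. (x, u) \<in> parcs G}"
  have fin: "finite (?N x)" "finite (leaves x)" for x
    using finite_verts by (auto simp: leaves_def)
  have nl: "a \<notin> leaves c2" "b \<notin> leaves c1" "b' \<notin> leaves c3" "c \<notin> leaves c2"
    using centres by (auto simp: leaves_def)
  have "card (leaves c1 \<union> (if a = c1 then {b} else {})) \<le> card (?N c1)"
    by (rule card_mono) (use fin leaves_nbs link ends in auto)
  thus "D1 \<le> card (?N c1)" unfolding D1_def using nl fin by (auto split: if_splits)
  have "card (leaves c3 \<union> (if c = c3 then {b'} else {})) \<le> card (?N c3)"
    by (rule card_mono) (use fin leaves_nbs link[THEN arcs_sym[OF G]] ends in auto)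
  thus "D3 \<le> card (?N c3)" unfolding D3_def using nl fin by (auto split: if_splits)
  have "card (leaves c2 \<union> ((if b = c2 then {a} else {}) \<union> (if b' = c2 then {c} else {}))) \<le> card (?N c2)"
    by (rule card_mono) (use fin leaves_nbs link(2) link(1)[THEN arcs_sym[OF G]] ends in auto)
  thus "D2 \<le> card (?N c2)" unfolding D2_def using nl fin link_distinct by (auto split: if_splits)
qed

text \<open>\<open>link_values\<close> supplies the values at the link ends for
  \<open>test_inequality\<close>; the squares for central ends occur on both sides and replace leaf
  counts by degrees. Strictness comes from the surplus of a shared leaf or from an edge outside the
  tree.\<close>

lemma
  fixes l x y z :: real
  assumes rho: "rho G \<le> l" and l: "l > 1" and xyz: "x \<ge> 0" "y \<ge> 0" "z \<ge> 0"
  defines "L \<equiv> link_energy p l x y + link_energy r l y z"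
    and "R \<equiv> (l\<^sup>2 - D1) * x\<^sup>2 + (l\<^sup>2 - D2) * y\<^sup>2 + (l\<^sup>2 - D3) * z\<^sup>2"
  shows energy_le: "L \<le> R"
    and energy_less: "\<lbrakk>x > 0; y > 0; z > 0; (b = b' \<and> b \<noteq> c2) \<or> \<not> parcs G \<subseteq> edges \<union> edges\<inverse>\<rbrakk> \<Longrightarrow> L < R"
proof -
  define X where "X v = (if v = c1 then x else if v = c2 then y else z)" for v
  have X: "X c1 = x" "X c2 = y" "X c3 = z" using centres by (auto simp: X_def)
  obtain ga gb where g1: "ga \<ge> 0" "gb \<ge> 0" "a = c1 \<Longrightarrow> ga = x" "a \<noteq> c1 \<Longrightarrow> l * ga = x + gb"
    "b = c2 \<Longrightarrow> gb = y" "b \<noteq> c2 \<Longrightarrow> l * gb = y + ga"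
    "2 * l * ga * gb - of_bool (a \<noteq> c1) * gb\<^sup>2 - of_bool (b \<noteq> c2) * ga\<^sup>2 =
       link_energy (3 - of_bool (a = c1) - of_bool (b = c2)) l x y + of_bool (a = c1) * x\<^sup>2 + of_bool (b = c2) * y\<^sup>2"
    "x > 0 \<Longrightarrow> y > 0 \<Longrightarrow> ga > 0 \<and> gb > 0"
    using link_values[OF l xyz(1,2), of "a = c1" "b = c2"] by metis
  obtain gb' gc where g2: "gb' \<ge> 0" "gc \<ge> 0" "b' = c2 \<Longrightarrow> gb' = y" "b' \<noteq> c2 \<Longrightarrow> l * gb' = y + gc"
    "c = c3 \<Longrightarrow> gc = z" "c \<noteq> c3 \<Longrightarrow> l * gc = z + gb'"
    "2 * l * gb' * gc - of_bool (b' \<noteq> c2) * gc\<^sup>2 - of_bool (c \<noteq> c3) * gb'\<^sup>2 =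
       link_energy (3 - of_bool (b' = c2) - of_bool (c = c3)) l y z + of_bool (b' = c2) * y\<^sup>2 + of_bool (c = c3) * z\<^sup>2"
    "y > 0 \<Longrightarrow> z > 0 \<Longrightarrow> gb' > 0 \<and> gc > 0"
    using link_values[OF l xyz(2,3), of "b' = c2" "c = c3"] by metis
  have l0: "l > 0" using l by simp
  let ?\<tau> = "of_bool (b = b' \<and> b \<noteq> c2) :: real"
  note T = test_inequality[where X = X and l = l and ga = ga and gb = gb and gb' = gb' and gc = gc,
      unfolded X, OF rho l0 xyz g1(1,2) g2(1,2) g1(3-6) g2(3-6)]
  have L: "2 * l * ga * gb - of_bool (a \<noteq> c1) * gb\<^sup>2 - of_bool (b \<noteq> c2) * ga\<^sup>2
     + 2 * l * gb' * gc - of_bool (b' \<noteq> c2) * gc\<^sup>2 - of_bool (c \<noteq> c3) * gb'\<^sup>2 + 2 * ?\<tau> * ga * gc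
     = L + of_bool (a = c1) * x\<^sup>2 + of_bool (b = c2) * y\<^sup>2 + of_bool (b' = c2) * y\<^sup>2 + of_bool (c = c3) * z\<^sup>2 + 2 * ?\<tau> * ga * gc"
    using g1(7) g2(7) unfolding L_def p_def r_def by linarith
  have R: "(l\<^sup>2 - card (leaves c1)) * x\<^sup>2 + (l\<^sup>2 - card (leaves c2)) * y\<^sup>2 + (l\<^sup>2 - card (leaves c3)) * z\<^sup>2
    = R + of_bool (a = c1) * x\<^sup>2 + of_bool (b = c2) * y\<^sup>2 + of_bool (b' = c2) * y\<^sup>2 + of_bool (c = c3) * z\<^sup>2"
    unfolding R_def D1_def D2_def D3_def by (simp add: algebra_simps)
  have le: "L + 2 * ?\<tau> * ga * gc \<le> R" using T(1) unfolding L R by linarith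
  moreover have "2 * ?\<tau> * ga * gc \<ge> 0" using g1 g2 by (intro mult_nonneg_nonneg) auto
  ultimately show "L \<le> R" by linarith
  assume pos: "x > 0" "y > 0" "z > 0" and *: "(b = b' \<and> b \<noteq> c2) \<or> \<not> parcs G \<subseteq> edges \<union> edges\<inverse>"
  show "L < R"
  proof (cases "b = b' \<and> b \<noteq> c2")
    case True
    hence "2 * ?\<tau> * ga * gc > 0" using g1(8) g2(8) pos by auto
    thus ?thesis using le by linarith
  next
    case False
    with * have "\<not> parcs G \<subseteq> edges \<union> edges\<inverse>" by blast
    from T(2)[OF _ _ _ _ _ _ _ _ pos this] \<open>2 * ?\<tau> * ga * gc \<ge> 0\<close> show ?thesis unfolding L R by linarith
  qed
qed

text \<open>With both lengths 3 all link ends are leaves, so the links and centres form the path of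
  \<open>G2\<close> and the remaining leaves are pendent. The links use up one leaf of each outer
  star and, as \<open>b \<noteq> b'\<close>, two of the middle star.\<close>

lemma iso_G2:
  assumes pr: "p = 3" "r = 3" and bb: "b \<noteq> b'" and arcs: "parcs G \<subseteq> edges \<union> edges\<inverse>"
  shows "digraph_iso (with_proj G) (with_proj (G2 (D1 - 1) (D2 - 2) (D3 - 1)))"
proof -
  have nc: "a \<noteq> c1" "b \<noteq> c2" "b' \<noteq> c2" "c \<noteq> c3" using pr by (auto simp: p_def r_def split: if_splits)
  hence W: "a \<in> W" "b \<in> W" "b' \<in> W" "c \<in> W" using link_centre link_verts by blast+
  define P1 P2 P3 where "P1 = leaves c1 - {a}" and "P2 = leaves c2 - {b, b'}" and "P3 = leaves c3 - {c}"
  have fin: "finite (leaves x)" for x using finite_verts by (auto simp: leaves_def)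
  have lv: "a \<in> leaves c1" "b \<in> leaves c2" "b' \<in> leaves c2" "c \<in> leaves c3"
    using W by (auto simp: leaves_def)
  have D: "D1 = card (leaves c1)" "D2 = card (leaves c2)" "D3 = card (leaves c3)"
    using nc by (auto simp: D1_def D2_def D3_def)
  have cardP: "card P1 = D1 - 1" "card P2 = D2 - 2" "card P3 = D3 - 1"
    unfolding D P1_def P2_def P3_def using lv bb fin by (simp_all add: card_Diff_subset)
  have D_ge: "D1 \<ge> 1" "D2 \<ge> 2" "D3 \<ge> 1"
    using card_mono[OF fin, of "{a}" c1] card_mono[OF fin, of "{b, b'}" c2] card_mono[OF fin, of "{c}" c3] lv bb
    unfolding D by auto
  have finP: "finite P1" "finite P2" "finite P3" using fin by (auto simp: P1_def P2_def P3_def)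
  obtain e1 where e1: "bij_betw e1 P1 {..<D1 - 1}"
    using ex_bij_betw_finite_nat[OF finP(1)] cardP by (auto simp: atLeast0LessThan)
  obtain e2 where e2: "bij_betw e2 P2 {..<D2 - 2}"
    using ex_bij_betw_finite_nat[OF finP(2)] cardP by (auto simp: atLeast0LessThan)
  obtain e3 where e3: "bij_betw e3 P3 {..<D3 - 1}"
    using ex_bij_betw_finite_nat[OF finP(3)] cardP by (auto simp: atLeast0LessThan)
  define \<phi> where "\<phi> v = (if v = c1 then V 1 else if v = c2 then V 2 else if v = c3 then V 3
     else if v = a then V 4 else if v = b then V 5 else if v = b' then V 6 else if v = c then V 7
     else if h v = c1 then Pend 1 (e1 v) else if h v = c2 then Pend 2 (e2 v) else Pend 3 (e3 v))" for v
  have \<phi>: "\<phi> c1 = V 1" "\<phi> c2 = V 2" "\<phi> c3 = V 3" "\<phi> a = V 4" "\<phi> b = V 5" "\<phi> b' = V 6" "\<phi> c = V 7"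
    using centres W link_distinct bb by (auto simp: \<phi>_def)
  have \<phi>P: "\<And>v. v \<in> P1 \<Longrightarrow> \<phi> v = Pend 1 (e1 v)" "\<And>v. v \<in> P2 \<Longrightarrow> \<phi> v = Pend 2 (e2 v)" "\<And>v. v \<in> P3 \<Longrightarrow> \<phi> v = Pend 3 (e3 v)"
    using centres unfolding P1_def P2_def P3_def leaves_def \<phi>_def by auto
  have Weq: "W = {a, b, b', c} \<union> P1 \<union> P2 \<union> P3"
    using W h_leaf unfolding P1_def P2_def P3_def leaves_def by blast
  have "pverts G = C \<union> W" using centres by auto
  hence Veq: "pverts G = {c1, c2, c3, a, b, b', c} \<union> P1 \<union> P2 \<union> P3" unfolding Weq by auto
  have im: "\<phi> ` P1 = Pend 1 ` {..<D1 - 1}" "\<phi> ` P2 = Pend 2 ` {..<D2 - 2}" "\<phi> ` P3 = Pend 3 ` {..<D3 - 1}"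
    using \<phi>P e1 e2 e3 by (auto simp: bij_betw_def image_image[symmetric] cong: image_cong_simp)
  let ?H = "G2 (D1 - 1) (D2 - 2) (D3 - 1)"
  have "{1..7::nat} = {1, 2, 3, 4, 5, 6, 7}" by auto
  hence "V ` {1..7} = \<phi> ` {c1, c2, c3, a, b, b', c}" using \<phi> by simp
  hence VH: "pverts ?H = \<phi> ` pverts G"
    unfolding Veq image_Un im by (simp add: G2_def)
  \<comment> \<open>\<open>\<phi>\<close> maps onto the vertices of \<open>?H\<close>, and both
    vertex sets have the same size.\<close>
  have inj: "inj_on \<phi> (pverts G)"
  proof (rule eq_card_imp_inj_on[OF finite_verts])
    show "card (\<phi> ` pverts G) = card (pverts G)"
      unfolding VH[symmetric] card_G2 card_verts using D D_ge by simp
  qed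
  have hP: "\<And>v. v \<in> P1 \<Longrightarrow> h v = c1" "\<And>v. v \<in> P2 \<Longrightarrow> h v = c2" "\<And>v. v \<in> P3 \<Longrightarrow> h v = c3"
    unfolding P1_def P2_def P3_def leaves_def by auto
  have edges: "edges = (\<lambda>v. (v, h v)) ` ({a, b, b', c} \<union> P1 \<union> P2 \<union> P3) \<union> {(a, b), (b', c)}"
    unfolding edges_def Weq ..
  have "map_prod \<phi> \<phi> ` edges =
      (\<lambda>v. (\<phi> v, \<phi> (h v))) ` {a, b, b', c} \<union> (\<lambda>v. (\<phi> v, \<phi> (h v))) ` P1 \<union> (\<lambda>v. (\<phi> v, \<phi> (h v))) ` P2
        \<union> (\<lambda>v. (\<phi> v, \<phi> (h v))) ` P3 \<union> {(\<phi> a, \<phi> b), (\<phi> b', \<phi> c)}"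
    unfolding edges image_Un image_image by simp
  also have "(\<lambda>v. (\<phi> v, \<phi> (h v))) ` P1 = (\<lambda>w. (w, V 1)) ` \<phi> ` P1"
    using hP \<phi> by (simp add: image_image)
  also have "(\<lambda>v. (\<phi> v, \<phi> (h v))) ` P2 = (\<lambda>w. (w, V 2)) ` \<phi> ` P2"
    using hP \<phi> by (simp add: image_image)
  also have "(\<lambda>v. (\<phi> v, \<phi> (h v))) ` P3 = (\<lambda>w. (w, V 3)) ` \<phi> ` P3"
    using hP \<phi> by (simp add: image_image)
  finally have E: "map_prod \<phi> \<phi> ` edges = {(V 4, V 1), (V 5, V 2), (V 6, V 2), (V 7, V 3), (V 4, V 5), (V 6, V 7)}
      \<union> (\<lambda>w. (w, V 1)) ` Pend 1 ` {..<D1 - 1} \<union> (\<lambda>w. (w, V 2)) ` Pend 2 ` {..<D2 - 2} \<union> (\<lambda>w. (w, V 3)) ` Pend 3 ` {..<D3 - 1}"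
    unfolding im by (auto simp: \<phi>)
  have "parcs G = edges \<union> edges\<inverse>" using arcs edges_subset arcs_sym[OF G] by auto
  moreover have "map_prod \<phi> \<phi> ` (edges\<inverse>) = (map_prod \<phi> \<phi> ` edges)\<inverse>" by force
  ultimately have "map_prod \<phi> \<phi> ` parcs G = map_prod \<phi> \<phi> ` edges \<union> (map_prod \<phi> \<phi> ` edges)\<inverse>"
    by (simp only: image_Un)
  \<comment> \<open>\<open>edges\<close> points from leaves to centres, \<open>G2_edges\<close> runs
    along the path and outwards, so only the symmetric closures agree.\<close>
  also have "\<dots> = parcs ?H"
  proof -
    let ?P = "\<lambda>i k. {(V i, Pend i j) | j. j < k}"
    have P: "(\<lambda>w. (w, V i)) ` Pend i ` {..<k} = (?P i k)\<inverse>" for i k by auto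
    have Un: "(F' \<union> A\<inverse> \<union> B\<inverse> \<union> K\<inverse>) \<union> (F' \<union> A\<inverse> \<union> B\<inverse> \<union> K\<inverse>)\<inverse> = (F \<union> A \<union> B \<union> K) \<union> (F \<union> A \<union> B \<union> K)\<inverse>"
      if eq: "F' \<union> F'\<inverse> = F \<union> F\<inverse>" for F F' A B K :: "g2_vertex rel"
    proof -
      let ?R = "A \<union> A\<inverse> \<union> (B \<union> B\<inverse>) \<union> (K \<union> K\<inverse>)"
      have "(F' \<union> A\<inverse> \<union> B\<inverse> \<union> K\<inverse>) \<union> (F' \<union> A\<inverse> \<union> B\<inverse> \<union> K\<inverse>)\<inverse> = (F' \<union> F'\<inverse>) \<union> ?R"
        by (simp only: converse_Un converse_converse Un_ac)
      also have "\<dots> = (F \<union> A \<union> B \<union> K) \<union> (F \<union> A \<union> B \<union> K)\<inverse>"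
        unfolding eq by (simp only: converse_Un converse_converse Un_ac)
      finally show ?thesis .
    qed
    have "{(V 4, V 1), (V 5, V 2), (V 6, V 2), (V 7, V 3), (V 4, V 5), (V 6, V 7)} \<union>
        {(V 4, V 1), (V 5, V 2), (V 6, V 2), (V 7, V 3), (V 4, V 5), (V 6, V 7)}\<inverse> =
        {(V 1, V 4), (V 4, V 5), (V 5, V 2), (V 2, V 6), (V 6, V 7), (V 7, V 3)} \<union>
        {(V 1, V 4), (V 4, V 5), (V 5, V 2), (V 2, V 6), (V 6, V 7), (V 7, V 3)}\<inverse>"
    proof -
      have "(insert (x, y) S)\<inverse> = insert (y, x) (S\<inverse>)" for x y :: g2_vertex and S by auto
      thus ?thesis by (simp add: insert_commute)
    qed
    from Un[OF this] show ?thesis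
      unfolding E P G2_def G2_edges_def by simp
  qed
  finally show ?thesis
    by (intro digraph_isoI[OF G inj VH]) simp
qed

end

section \<open>Three linked stars from domination and connectivity\<close>

text \<open>\<open>h\<close> picks a dominating neighbour for each vertex outside \<open>D\<close>.
  Contracting its three classes leaves a connected graph on three vertices, which contains a
  path.\<close>

lemma three_stars_exists:
  assumes G: "pair_graph G" and con: "Digraph_Component.connected (with_proj G)"
    and dom: "dominating G D" "card D = 3"
  obtains c1 c2 c3 h a b b' c where "three_stars G c1 c2 c3 h a b b' c"
proof -
  interpret pair_graph G by fact
  have DV: "D \<subseteq> pverts G" using dom by (simp add: dominating_def)
  define h where "h v = (if v \<in> D then v else SOME u. u \<in> D \<and> (v, u) \<in> parcs G)" for v
  have h1: "h v = v" if "v \<in> D" for v using that by (simp add: h_def)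
  have h2: "h v \<in> D \<and> (v, h v) \<in> parcs G" if "v \<in> pverts G - D" for v
  proof -
    have "\<exists>u. u \<in> D \<and> (v, u) \<in> parcs G" using dom(1) that by (auto simp: dominating_def)
    from someI_ex[OF this] that show ?thesis by (simp add: h_def)
  qed
  have h3: "h v \<in> D" if "v \<in> pverts G" for v using h1 h2 that by (cases "v \<in> D") auto
  have cross: "\<exists>u w. (u, w) \<in> parcs G \<and> h u = x \<and> h w \<in> D - {x}" if x: "x \<in> D" for x
  proof -
    have "card (D - {x}) = 2" using dom(2) x by (simp add: card_Diff_singleton)
    then obtain y where y: "y \<in> D - {x}" by (metis card.empty ex_in_conv zero_neq_numeral)
    let ?S = "{v \<in> pverts G. h v = x}"
    have "x \<in> ?S" "y \<in> pverts G - ?S" using x y DV h1[of x] h1[of y] by auto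
    hence "?S \<noteq> {}" "?S \<noteq> pverts G" by blast+
    then obtain u w where uw: "u \<in> ?S" "w \<in> pverts G - ?S" "(u, w) \<in> parcs G"
      using connected_crossing_arc[OF G con, of ?S] by auto
    hence "h u = x" "h w \<in> D - {x}" using h3[of w] by auto
    thus ?thesis using uw(3) by blast
  qed
  obtain x where x: "x \<in> D" using dom(2) by (metis card.empty ex_in_conv zero_neq_numeral)
  obtain u w where uw: "(u, w) \<in> parcs G" "h u = x" "h w \<in> D - {x}" using cross[OF x] by blast
  define y where "y = h w"
  have y: "y \<in> D" "y \<noteq> x" using uw by (auto simp: y_def)
  have "card (D - {x, y}) = 1" using dom(2) x y by (simp add: card_Diff_subset)
  then obtain k where k: "D - {x, y} = {k}" by (rule card_1_singletonE)
  hence D: "D = {x, y, k}" "k \<noteq> x" "k \<noteq> y" using x y by auto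
  obtain s t where st: "(s, t) \<in> parcs G" "h s = k" "h t \<in> D - {k}" using cross[of k] D by blast
  have hD: "h x = x" "h y = y" "h k = k" using h1 D by auto
  have V: "x \<in> pverts G" "y \<in> pverts G" "k \<in> pverts G" using DV D by auto
  have ne: "x \<noteq> y" "x \<noteq> k" "y \<noteq> k" "y \<noteq> x" using D y by auto
  have hl: "h v \<in> {x, y, k} \<and> (v, h v) \<in> parcs G" if "v \<in> pverts G - {x, y, k}" for v
    using h2[of v] that unfolding D(1) .
  have hl': "h v \<in> {y, x, k} \<and> (v, h v) \<in> parcs G" if "v \<in> pverts G - {y, x, k}" for v
    using hl[of v] that by (simp only: insert_commute)
  have arcs: "(w, u) \<in> parcs G" "(t, s) \<in> parcs G" using arcs_sym[OF G] uw(1) st(1) by auto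
  have hw: "h w = y" by (simp add: y_def)
  \<comment> \<open>The third class is linked to one of the two classes linked before, and that one
    becomes the middle star.\<close>
  consider "h t = y" | "h t = x" using st(3) D by auto
  thus ?thesis
  proof cases
    case 1
    have "three_stars G x y k h u w t s"
      by (rule three_stars.intro) fact+
    thus ?thesis by (rule that)
  next
    case 2
    have "three_stars G y x k h w u t s"
      by (rule three_stars.intro) fact+
    thus ?thesis by (rule that)
  qed
qed

lemma domination_number_attained:
  assumes "pair_graph G"
  obtains D where "dominating G D" "card D = domination_number G"
proof -
  interpret pair_graph G by fact
  have "finite {D. dominating G D}"
    by (rule finite_subset[of _ "Pow (pverts G)"]) (use pair_finite_verts in \<open>auto simp: dominating_def\<close>)
  moreover have "dominating G (pverts G)" by (simp add: dominating_def)
  ultimately have "domination_number G \<in> card ` {D. dominating G D}"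
    unfolding domination_number_def by (intro Min_in) auto
  thus ?thesis using that by auto
qed

lemma domination_number_le:
  assumes "pair_graph G" "dominating G D"
  shows "domination_number G \<le> card D"
proof -
  interpret pair_graph G by fact
  have "finite {D. dominating G D}"
    by (rule finite_subset[of _ "Pow (pverts G)"]) (use pair_finite_verts in \<open>auto simp: dominating_def\<close>)
  thus ?thesis unfolding domination_number_def using assms(2) by (intro Min_le) auto
qed

text \<open>No single vertex dominates, so \<open>degree_less_rho_bound\<close> applies to each
  centre. By \<open>energy_less\<close>, equality at a positive point rules out a shared leaf and
  any edge outside the tree, and then \<open>iso_G2\<close> applies.\<close>

lemma small_rho_structure:
  assumes "G \<in> conn_graphs_dom n 3" and rho: "rho G \<le> l" and l: "l > 1"
  obtains d1 d2 d3 p r :: nat where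
    "p \<in> {1, 2, 3}" "r \<in> {1, 2, 3}" "d1 + d2 + d3 + p + r = n + 3"
    "real d1 < l\<^sup>2" "real d2 < l\<^sup>2" "real d3 < l\<^sup>2"
    "\<And>x y z. \<lbrakk>x \<ge> 0; y \<ge> 0; z \<ge> 0\<rbrakk> \<Longrightarrow> link_energy p l x y + link_energy r l y z
       \<le> (l\<^sup>2 - d1) * x\<^sup>2 + (l\<^sup>2 - d2) * y\<^sup>2 + (l\<^sup>2 - d3) * z\<^sup>2"
    "\<And>x y z. \<lbrakk>p = 3; r = 3; x > 0; y > 0; z > 0; link_energy p l x y + link_energy r l y z
       = (l\<^sup>2 - d1) * x\<^sup>2 + (l\<^sup>2 - d2) * y\<^sup>2 + (l\<^sup>2 - d3) * z\<^sup>2\<rbrakk> \<Longrightarrow>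
       digraph_iso (with_proj G) (with_proj (G2 (d1 - 1) (d2 - 2) (d3 - 1)))"
proof -
  have G: "pair_graph G" and con: "Digraph_Component.connected (with_proj G)"
    and n: "card (pverts G) = n" and dn: "domination_number G = 3"
    using assms(1) by (auto simp: conn_graphs_dom_def)
  obtain D where D: "dominating G D" "card D = 3"
    using domination_number_attained[OF G] dn by metis
  obtain c1 c2 c3 h a b b' c where "three_stars G c1 c2 c3 h a b b' c"
    using three_stars_exists[OF G con D] by blast
  then interpret three_stars G c1 c2 c3 h a b b' c .
  have deg: "real (card {u \<in> pverts G. (x, u) \<in> parcs G}) < l\<^sup>2" if x: "x \<in> pverts G" for x
  proof -
    have "\<not> dominating G {x}" using domination_number_le[OF G, of "{x}"] dn by auto
    then obtain w where "w \<in> pverts G" "w \<noteq> x" "(w, x) \<notin> parcs G"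
      using x by (auto simp: dominating_def)
    thus ?thesis using degree_less_rho_bound[OF G con x rho] l arcs_sym[OF G] by fastforce
  qed
  show ?thesis
  proof (rule that[of p r D1 D2 D3])
    show "p \<in> {1, 2, 3}" "r \<in> {1, 2, 3}" by (rule lengths)+
    show "D1 + D2 + D3 + p + r = n + 3" using sum_degrees n by simp
    show "real D1 < l\<^sup>2" "real D2 < l\<^sup>2" "real D3 < l\<^sup>2"
      using degree_ge deg[OF centres(1)] deg[OF centres(2)] deg[OF centres(3)] by linarith+
    show "link_energy p l x y + link_energy r l y z
       \<le> (l\<^sup>2 - D1) * x\<^sup>2 + (l\<^sup>2 - D2) * y\<^sup>2 + (l\<^sup>2 - D3) * z\<^sup>2" if "x \<ge> 0" "y \<ge> 0" "z \<ge> 0" for x y z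
      using energy_le[OF rho l that] .
    fix x y z :: real
    assume *: "p = 3" "r = 3" "x > 0" "y > 0" "z > 0" "link_energy p l x y + link_energy r l y z
       = (l\<^sup>2 - D1) * x\<^sup>2 + (l\<^sup>2 - D2) * y\<^sup>2 + (l\<^sup>2 - D3) * z\<^sup>2"
    have "\<not> ((b = b' \<and> b \<noteq> c2) \<or> \<not> parcs G \<subseteq> edges \<union> edges\<inverse>)"
      using energy_less[OF rho l, of x y z] * by auto
    moreover have "b \<noteq> c2" using * by (auto simp: p_def split: if_splits)
    ultimately show "digraph_iso (with_proj G) (with_proj (G2 (D1 - 1) (D2 - 2) (D3 - 1)))"
      using iso_G2 * by blast
  qed
qed

section \<open>The extremal graph\<close>

lemma adj_sum_G2:
  "adj_sum (G2 a b c) f (V 1) = f (V 4) + (\<Sum>j<a. f (Pend 1 j))"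
  "adj_sum (G2 a b c) f (V 2) = f (V 5) + f (V 6) + (\<Sum>j<b. f (Pend 2 j))"
  "adj_sum (G2 a b c) f (V 3) = f (V 7) + (\<Sum>j<c. f (Pend 3 j))"
  "adj_sum (G2 a b c) f (V 4) = f (V 1) + f (V 5)"
  "adj_sum (G2 a b c) f (V 5) = f (V 4) + f (V 2)"
  "adj_sum (G2 a b c) f (V 6) = f (V 2) + f (V 7)"
  "adj_sum (G2 a b c) f (V 7) = f (V 6) + f (V 3)"
  "j < a \<Longrightarrow> adj_sum (G2 a b c) f (Pend 1 j) = f (V 1)"
  "j < b \<Longrightarrow> adj_sum (G2 a b c) f (Pend 2 j) = f (V 2)"
  "j < c \<Longrightarrow> adj_sum (G2 a b c) f (Pend 3 j) = f (V 3)"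
proof -
  let ?N = "\<lambda>v. {u \<in> pverts (G2 a b c). (v, u) \<in> parcs (G2 a b c)}"
  have N: "?N (V 1) = insert (V 4) (Pend 1 ` {..<a})"
    "?N (V 2) = insert (V 5) (insert (V 6) (Pend 2 ` {..<b}))"
    "?N (V 3) = insert (V 7) (Pend 3 ` {..<c})"
    "?N (V 4) = {V 1, V 5}" "?N (V 5) = {V 4, V 2}" "?N (V 6) = {V 2, V 7}" "?N (V 7) = {V 6, V 3}"
    "j < a \<Longrightarrow> ?N (Pend 1 j) = {V 1}" "j < b \<Longrightarrow> ?N (Pend 2 j) = {V 2}" "j < c \<Longrightarrow> ?N (Pend 3 j) = {V 3}"
    by (auto simp: G2_def G2_edges_def)
  have P: "(\<Sum>u\<in>Pend i ` S. f u) = (\<Sum>j\<in>S. f (Pend i j))" for i S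
    by (subst sum.reindex) (auto simp: inj_on_def)
  have ins: "sum f (insert x S) = f x + sum f S" if "finite S" "x \<notin> S" for x S
    using that by (rule sum.insert)
  show "adj_sum (G2 a b c) f (V 1) = f (V 4) + (\<Sum>j<a. f (Pend 1 j))"
    "adj_sum (G2 a b c) f (V 2) = f (V 5) + f (V 6) + (\<Sum>j<b. f (Pend 2 j))"
    "adj_sum (G2 a b c) f (V 3) = f (V 7) + (\<Sum>j<c. f (Pend 3 j))"
    "adj_sum (G2 a b c) f (V 4) = f (V 1) + f (V 5)"
    "adj_sum (G2 a b c) f (V 5) = f (V 4) + f (V 2)"
    "adj_sum (G2 a b c) f (V 6) = f (V 2) + f (V 7)"
    "adj_sum (G2 a b c) f (V 7) = f (V 6) + f (V 3)"
    "j < a \<Longrightarrow> adj_sum (G2 a b c) f (Pend 1 j) = f (V 1)"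
    "j < b \<Longrightarrow> adj_sum (G2 a b c) f (Pend 2 j) = f (V 2)"
    "j < c \<Longrightarrow> adj_sum (G2 a b c) f (Pend 3 j) = f (V 3)"
    unfolding adj_sum_def N by (subst ins P | force | simp add: N)+
qed

lemma G2_vertex_cases:
  assumes "v \<in> pverts (G2 a b c)"
  obtains "v = V 1" | "v = V 2" | "v = V 3" | "v = V 4" | "v = V 5" | "v = V 6" | "v = V 7"
    | j where "j < a" "v = Pend 1 j" | j where "j < b" "v = Pend 2 j" | j where "j < c" "v = Pend 3 j"
proof -
  have "{1..7::nat} = {1, 2, 3, 4, 5, 6, 7}" by auto
  hence "v \<in> {V 1, V 2, V 3, V 4, V 5, V 6, V 7} \<union> Pend 1 ` {..<a} \<union> Pend 2 ` {..<b} \<union> Pend 3 ` {..<c}"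
    using assms by (simp add: G2_def)
  thus ?thesis using that by blast
qed

text \<open>For values \<open>x\<close> at the outer centres and \<open>y\<close> at the middle one,
  eliminating all other vertices leaves the equations \<open>P * x = l * y\<close> and
  \<open>((l\<^sup>2 - (b + 2)) * (l\<^sup>2 - 1) - 2) * y = 2 * l * x\<close>. The first is solved
  by \<open>x = l\<close>, \<open>y = P\<close>, and the second then becomes
  \<open>eq\<close>.\<close>

lemma rho_G2_symmetric:
  fixes l :: real and a b :: nat
  assumes l: "l > 1" and P: "P = (l\<^sup>2 - (a + 1)) * (l\<^sup>2 - 1) - 1" "P > 0"
    and eq: "((l\<^sup>2 - (b + 2)) * (l\<^sup>2 - 1) - 2) * P = 2 * l\<^sup>2"
  shows "rho (G2 a b a) = l"
proof -
  define q where "q = l\<^sup>2"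
  have q: "q - 1 > 0" using l by (simp add: q_def one_less_power)
  have l0: "l > 0" using l by simp
  have ll: "l * l = q" by (simp add: q_def power2_eq_square)
  \<comment> \<open>Pendent vertices carry the value of their centre divided by \<open>l\<close>;
    \<open>V 4\<close> to \<open>V 7\<close> carry the values found in \<open>link_values\<close>
    for length 3.\<close>
  define f where "f v = (case v of
      V i \<Rightarrow> (if i = 1 \<or> i = 3 then l else if i = 2 then P
               else if i = 4 \<or> i = 7 then (q + P) / (q - 1) else l * (1 + P) / (q - 1))
    | Pend i j \<Rightarrow> (if i = 2 then P / l else 1))" for v
  have f: "f (V 1) = l" "f (V 2) = P" "f (V 3) = l" "f (V 4) = (q + P) / (q - 1)" "f (V 5) = l * (1 + P) / (q - 1)"
    "f (V 6) = l * (1 + P) / (q - 1)" "f (V 7) = (q + P) / (q - 1)" "f (Pend 1 j) = 1" "f (Pend 2 j) = P / l" "f (Pend 3 j) = 1" for j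
    by (auto simp: f_def)
  have e1: "(q + P) / (q - 1) + a = l * l"
    unfolding ll P(1) using q by (simp add: q_def[symmetric] field_simps)
  have e2: "l * (1 + P) / (q - 1) + l * (1 + P) / (q - 1) + b * (P / l) = l * P"
  proof -
    have "(2 * q * (1 + P) + b * P * (q - 1)) = q * P * (q - 1)"
      using eq unfolding q_def[symmetric] by (simp add: algebra_simps)
    moreover have "l * (1 + P) / (q - 1) = (l * l) * (1 + P) / (l * (q - 1))"
      "b * (P / l) = b * P * (q - 1) / (l * (q - 1))" "l * P = (l * l) * P * (q - 1) / (l * (q - 1))"
      using l0 q by simp_all
    ultimately show ?thesis
      by (simp only: ll add_divide_distrib[symmetric]) (simp add: algebra_simps)
  qed
  have e4: "l + l * (1 + P) / (q - 1) = l * ((q + P) / (q - 1))" using q by (simp add: field_simps)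
  have e5: "(q + P) / (q - 1) + P = l * (l * (1 + P) / (q - 1))"
  proof -
    have "l * (l * (1 + P) / (q - 1)) = l * l * (1 + P) / (q - 1)" by simp
    also have "\<dots> = (q + P + P * (q - 1)) / (q - 1)" unfolding ll by (simp add: algebra_simps)
    also have "\<dots> = (q + P) / (q - 1) + P" using q by (simp add: add_divide_distrib)
    finally show ?thesis by simp
  qed
  show ?thesis
  proof (rule rho_eq_of_positive_eigenfunction[OF pair_graph_G2, where f = f])
    have "V 1 \<in> pverts (G2 a b a)" by (auto simp: G2_def)
    thus "pverts (G2 a b a) \<noteq> {}" by auto
    fix v assume "v \<in> pverts (G2 a b a)"
    thus "f v > 0"
      by (cases rule: G2_vertex_cases) (use l0 q P(2) in \<open>simp_all add: f del: One_nat_def\<close>)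
    show "adj_sum (G2 a b a) f v = l * f v"
      using \<open>v \<in> _\<close> by (cases rule: G2_vertex_cases)
        (use e1 e2 e4 e5 l0 in \<open>simp_all only: adj_sum_G2 f sum_constant card_lessThan, simp_all add: add_ac\<close>)
  qed
qed

section \<open>Reduction to a classification of lengths and degrees\<close>

text \<open>The condition that \<open>rho G \<le> l\<close> imposes on link lengths and degrees; the
  classifications below work with these numbers alone.\<close>

definition admissible :: "real \<Rightarrow> nat \<Rightarrow> nat \<Rightarrow> nat \<Rightarrow> nat \<Rightarrow> nat \<Rightarrow> bool" where
  "admissible l p r d1 d2 d3 \<longleftrightarrow> (\<forall>x y z. x \<ge> 0 \<longrightarrow> y \<ge> 0 \<longrightarrow> z \<ge> 0 \<longrightarrow>
     link_energy p l x y + link_energy r l y z \<le> (l\<^sup>2 - d1) * x\<^sup>2 + (l\<^sup>2 - d2) * y\<^sup>2 + (l\<^sup>2 - d3) * z\<^sup>2)"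

lemma link_energy_commute: "link_energy p l x y = link_energy p l y x"
  by (simp add: link_energy_def algebra_simps)

lemma admissible_sym: "admissible l p r d1 d2 d3 \<longleftrightarrow> admissible l r p d3 d2 d1"
proof -
  have "admissible l r p d3 d2 d1" if "admissible l p r d1 d2 d3" for p r d1 d2 d3
    unfolding admissible_def
  proof (intro allI impI)
    fix x y z :: real assume "x \<ge> 0" "y \<ge> 0" "z \<ge> 0"
    hence "link_energy p l z y + link_energy r l y x \<le> (l\<^sup>2 - d1) * z\<^sup>2 + (l\<^sup>2 - d2) * y\<^sup>2 + (l\<^sup>2 - d3) * x\<^sup>2"
      using that by (auto simp: admissible_def)
    thus "link_energy r l x y + link_energy p l y z \<le> (l\<^sup>2 - d3) * x\<^sup>2 + (l\<^sup>2 - d2) * y\<^sup>2 + (l\<^sup>2 - d1) * z\<^sup>2"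
      by (simp add: link_energy_commute[of r l x] link_energy_commute[of p l y])
  qed
  thus ?thesis by blast
qed

lemma admissibleD:
  assumes "admissible l p r d1 d2 d3" "x \<ge> 0" "y \<ge> 0" "z \<ge> 0"
  shows "link_energy p l x y + link_energy r l y z \<le> (l\<^sup>2 - d1) * x\<^sup>2 + (l\<^sup>2 - d2) * y\<^sup>2 + (l\<^sup>2 - d3) * z\<^sup>2"
  using assms by (auto simp: admissible_def)

lemma admissible_33D:
  assumes "admissible l 3 3 d1 d2 d3" "l > 1" "x \<ge> 0" "y \<ge> 0" "z \<ge> 0"
  shows "x\<^sup>2 + 2 * y\<^sup>2 + z\<^sup>2 + 2 * l * y * (x + z) \<le>
    (l\<^sup>2 - 1) * ((l\<^sup>2 - d1) * x\<^sup>2 + (l\<^sup>2 - d2) * y\<^sup>2 + (l\<^sup>2 - d3) * z\<^sup>2)"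
proof -
  have q: "l\<^sup>2 - 1 > 0" using assms(2) by (simp add: one_less_power)
  have "(x\<^sup>2 + 2 * y\<^sup>2 + z\<^sup>2 + 2 * l * y * (x + z)) / (l\<^sup>2 - 1) = link_energy 3 l x y + link_energy 3 l y z"
    by (simp add: link_energy_def add_divide_distrib[symmetric] algebra_simps)
  also have "\<dots> \<le> (l\<^sup>2 - d1) * x\<^sup>2 + (l\<^sup>2 - d2) * y\<^sup>2 + (l\<^sup>2 - d3) * z\<^sup>2"
    by (rule admissibleD) (use assms in auto)
  finally show ?thesis using q by (simp add: field_simps)
qed

text \<open>\<open>l\<close> is the spectral radius of the extremal graph. If
  \<open>rho G \<le> l\<close>, then \<open>cls\<close> forces the extremal lengths and degrees. At
  the centre values \<open>(l, P, l)\<close> of the positive eigenfunction the inequality is an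
  equality, so \<open>G\<close> is the extremal graph.\<close>

lemma minimal_rho_from_classification:
  fixes l :: real and n d1 d2 :: nat
  assumes G: "G \<in> conn_graphs_dom n 3"
    and l: "l > 1" and P: "P = (l\<^sup>2 - d1) * (l\<^sup>2 - 1) - 1" "P > 0" and d: "d1 \<ge> 1" "d2 \<ge> 2"
    and eq: "((l\<^sup>2 - d2) * (l\<^sup>2 - 1) - 2) * P = 2 * l\<^sup>2"
    and cls: "\<And>p r e1 e2 e3. \<lbrakk>p \<in> {1, 2, 3}; r \<in> {1, 2, 3}; e1 + e2 + e3 + p + r = n + 3;
      real e1 < l\<^sup>2; real e2 < l\<^sup>2; real e3 < l\<^sup>2; admissible l p r e1 e2 e3\<rbrakk> \<Longrightarrow>
      p = 3 \<and> r = 3 \<and> e1 = d1 \<and> e2 = d2 \<and> e3 = d1"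
  shows "rho G \<ge> rho (G2 (d1 - 1) (d2 - 2) (d1 - 1)) \<and>
    (rho G = rho (G2 (d1 - 1) (d2 - 2) (d1 - 1)) \<longleftrightarrow>
      digraph_iso (with_proj G) (with_proj (G2 (d1 - 1) (d2 - 2) (d1 - 1))))"
proof -
  let ?H = "G2 (d1 - 1) (d2 - 2) (d1 - 1)"
  have H: "rho ?H = l"
    by (rule rho_G2_symmetric[OF l, of P]) (use P d eq in \<open>auto simp: of_nat_diff\<close>)
  have pg: "pair_graph G" using G by (simp add: conn_graphs_dom_def)
  have ne: "pverts G \<noteq> {}" using G by (auto simp: conn_graphs_dom_def connected_conv)
  have iso: "digraph_iso (with_proj G) (with_proj ?H)" if rho: "rho G \<le> l"
  proof (rule small_rho_structure[OF G rho l])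
    fix e1 e2 e3 p r :: nat
    assume s:
      "p \<in> {1, 2, 3}" "r \<in> {1, 2, 3}" "e1 + e2 + e3 + p + r = n + 3"
      "real e1 < l\<^sup>2" "real e2 < l\<^sup>2" "real e3 < l\<^sup>2"
      "\<And>x y z. \<lbrakk>x \<ge> 0; y \<ge> 0; z \<ge> 0\<rbrakk> \<Longrightarrow> link_energy p l x y + link_energy r l y z
         \<le> (l\<^sup>2 - e1) * x\<^sup>2 + (l\<^sup>2 - e2) * y\<^sup>2 + (l\<^sup>2 - e3) * z\<^sup>2"
      "\<And>x y z. \<lbrakk>p = 3; r = 3; x > 0; y > 0; z > 0; link_energy p l x y + link_energy r l y z
         = (l\<^sup>2 - e1) * x\<^sup>2 + (l\<^sup>2 - e2) * y\<^sup>2 + (l\<^sup>2 - e3) * z\<^sup>2\<rbrakk> \<Longrightarrow>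
         digraph_iso (with_proj G) (with_proj (G2 (e1 - 1) (e2 - 2) (e3 - 1)))"
    have "admissible l p r e1 e2 e3" using s(7) by (auto simp: admissible_def)
    from cls[OF s(1-6) this] have e: "p = 3" "r = 3" "e1 = d1" "e2 = d2" "e3 = d1" by auto
    define q where "q = l\<^sup>2"
    have q: "q - 1 > 0" using l by (simp add: q_def one_less_power)
    have x1: "(q - d1) = (P + 1) / (q - 1)" using P(1) q by (simp add: q_def[symmetric] field_simps)
    have x2: "(q - d2) = (2 + 2 * q / P) / (q - 1)"
    proof -
      have "(q - d2) * (q - 1) - 2 = 2 * q / P" using eq P(2) by (simp add: q_def[symmetric] eq_divide_eq)
      hence "(q - d2) * (q - 1) = 2 + 2 * q / P" by linarith
      thus ?thesis using q by (simp only: eq_divide_eq) simp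
    qed
    have "link_energy 3 l l P + link_energy 3 l P l = (2 * q + 2 * P\<^sup>2 + 4 * q * P) / (q - 1)"
      by (simp add: link_energy_def q_def[symmetric] add_divide_distrib[symmetric])
         (simp add: q_def power2_eq_square algebra_simps)
    also have "\<dots> = (q - d1) * q + (q - d2) * P\<^sup>2 + (q - d1) * q"
    proof -
      have "(2 + 2 * q / P) * P\<^sup>2 = 2 * P\<^sup>2 + 2 * q * P" using P(2) by (simp add: field_simps power2_eq_square)
      thus ?thesis unfolding x1 x2 times_divide_eq_left add_divide_distrib[symmetric]
        by (simp add: algebra_simps)
    qed
    finally have "link_energy 3 l l P + link_energy 3 l P l = (l\<^sup>2 - d1) * l\<^sup>2 + (l\<^sup>2 - d2) * P\<^sup>2 + (l\<^sup>2 - d1) * l\<^sup>2"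
      by (simp add: q_def)
    thus ?thesis using s(8)[of l P l] e l P(2) by simp
  qed
  show ?thesis
  proof (intro conjI iffI)
    show "rho G \<ge> rho ?H"
    proof (cases "rho G \<le> l")
      case True
      thus ?thesis using rho_digraph_iso[OF pg pair_graph_G2 ne iso] by simp
    next
      case False
      thus ?thesis unfolding H by simp
    qed
    show "digraph_iso (with_proj G) (with_proj ?H)" if "rho G = rho ?H" using iso that H by simp
    show "rho G = rho ?H" if "digraph_iso (with_proj G) (with_proj ?H)"
      by (rule rho_digraph_iso[OF pg pair_graph_G2 ne that])
  qed
qed

section \<open>Classification of the degrees\<close>

text \<open>All degrees are at most \<open>m\<close>, and in total they fall short of this by
  \<open>p + r - 5\<close>, which is 0 or 1. Every case but the extremal one has two linked centres
  of degree \<open>m\<close>, and weight 1 on just these two contradicts admissibility.\<close>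

lemma classification_mod3_2:
  fixes l q :: real and m :: nat
  assumes m: "m \<ge> 3" and l: "l > 0" "l\<^sup>2 = q" and q: "m < q" "q \<le> real m + 1" and root: "(q - m) * (q - 1) = 3"
    and pr: "p \<in> {1, 2, 3}" "r \<in> {1, 2, 3}" and sum: "e1 + e2 + e3 + p + r = 3 * m + 2 + 3"
    and e: "real e1 < q" "real e2 < q" "real e3 < q" and adm: "admissible l p r e1 e2 e3"
  shows "p = 3 \<and> r = 3 \<and> e1 = m \<and> e2 = m - 1 \<and> e3 = m"
proof -
  have q4: "q \<ge> 4"
  proof (rule ccontr)
    assume "\<not> q \<ge> 4"
    moreover from this have "m = 3" using q m by linarith
    ultimately have "(q - m) * (q - 1) < 1 * 3" using q by (intro mult_strict_mono) auto
    thus False using root by simp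
  qed
  have l2: "l \<ge> 2" using l q4 by (intro power2_le_imp_le[of 2 l]) auto
  have em: "e1 \<le> m" "e2 \<le> m" "e3 \<le> m" using e q by linarith+
  have l1: "l > 1" using l2 by simp
  have no23: False if "admissible l 2 3 m m m"
  proof -
    have "2 + 1 / (q - 1) \<le> 2 * (q - m)"
      using admissibleD[OF that, of 1 1 0] l by (simp add: link_energy_def)
    moreover have "1 / (q - 1) > 0" using q4 by simp
    ultimately show False using q by argo
  qed
  \<comment> \<open>The root equation makes the right side 6, while \<open>l \<ge> 2\<close> makes
    the left side at least 7.\<close>
  have no33: False if "admissible l 3 3 m m e" for e
  proof -
    have "3 + 2 * l \<le> (q - 1) * ((q - m) + (q - m))"
      using admissible_33D[OF that l1, of 1 1 0] l by simp
    also have "\<dots> = 6" using root by (simp add: algebra_simps)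
    finally show False using l2 by simp
  qed
  have "p + r \<ge> 5" using sum em by linarith
  then consider "p = 2" "r = 3" | "p = 3" "r = 2" | "p = 3" "r = 3" using pr by auto
  thus ?thesis
  proof cases
    case 1
    hence "e1 = m" "e2 = m" "e3 = m" using sum em by linarith+
    thus ?thesis using no23 adm 1 by blast
  next
    case 2
    hence "e1 = m" "e2 = m" "e3 = m" using sum em by linarith+
    thus ?thesis using no23 adm 2 admissible_sym by blast
  next
    case 3
    consider "e1 = m" "e2 = m" | "e2 = m" "e3 = m" | "e1 = m" "e3 = m" "e2 = m - 1"
      using sum em 3 m by linarith
    thus ?thesis
      using no33[of e3] no33[of e1] adm admissible_sym[of l 3 3 e1 e2 e3] 3 by cases auto
  qed
qed

text \<open>The degrees fall short of \<open>m\<close> by \<open>p + r - 4\<close> in total. A link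
  shorter than 3, or one joining two centres of degree \<open>m\<close>, is refuted by a test point
  on two linked centres. The two other cases need approximate eigenfunctions on all three.\<close>

lemma classification_mod3_1:
  fixes l q s :: real and m :: nat
  assumes m: "m \<ge> 4" and l: "l > 0" "l\<^sup>2 = q" and q: "m < q" "q < real m + 1"
    and s: "s = (q - m) * (q - 1)" "s > 2" and root: "(s - 1) * (s + 2 * q - 4) = 2 * q"
    and pr: "p \<in> {1, 2, 3}" "r \<in> {1, 2, 3}" and sum: "e1 + e2 + e3 + p + r = 3 * m + 1 + 3"
    and e: "real e1 < q" "real e2 < q" "real e3 < q" and adm: "admissible l p r e1 e2 e3"
  shows "p = 3 \<and> r = 3 \<and> e1 = m \<and> e2 = m - 2 \<and> e3 = m"
proof -
  have q4: "q > 4" using q m by linarith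
  have l2: "l \<ge> 2" using l q4 by (intro power2_le_imp_le[of 2 l]) auto
  have l1: "l > 1" using l2 by simp
  have em: "e1 \<le> m" "e2 \<le> m" "e3 \<le> m" using e q by linarith+
  define t where "t = s - 2"
  have t0: "t > 0" using s by (simp add: t_def)
  have troot: "(1 + t) * (2 * q - 2 + t) = 2 * q" using root by (simp add: t_def algebra_simps)
  \<comment> \<open>\<open>s\<close> exceeds 2 only slightly: at \<open>t = 2 / 7\<close> the left
    side of \<open>troot\<close> is already above \<open>2 * q\<close>, because
    \<open>q > 4\<close>.\<close>
  have t1: "t < 2 / 7"
  proof (rule ccontr)
    assume "\<not> t < 2 / 7"
    hence "(1 + 2 / 7) * (2 * q - 2 + 2 / 7) \<le> (1 + t) * (2 * q - 2 + t)"
      using q4 by (intro mult_mono) auto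
    thus False using troot q4 by simp
  qed
  \<comment> \<open>Otherwise \<open>s\<close> is at least
    \<open>7 / 10 * (37 / 10) = 259 / 100\<close>, above the bound 16/7 given by
    \<open>t1\<close>.\<close>
  have d1: "q - m < 7 / 10"
  proof (rule ccontr)
    assume "\<not> q - m < 7 / 10"
    hence "7 / 10 * (37 / 10) \<le> (q - m) * (q - 1)" using m by (intro mult_mono) auto
    thus False using s t1 by (simp add: t_def)
  qed
  define w where "w = 1 / (q - 1)"
  have w0: "w > 0" using q4 by (simp add: w_def)
  have qmw: "q - m = s * w" using s(1) q4 by (simp add: w_def)
  have no13: False if "admissible l 1 3 m m m"
  proof -
    have "2 * l - 2 + w \<le> 2 * (q - m)"
      using admissibleD[OF that, of 1 1 0] l by (simp add: link_energy_def w_def)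
    thus False using w0 l2 q by argo
  qed
  have no22: False if "admissible l 2 2 m m m"
    using admissibleD[OF that, of 1 1 0] l q by (simp add: link_energy_def)
  have no23a: False if "admissible l 2 3 m m e" for e
  proof -
    have "2 + w \<le> 2 * (q - m)"
      using admissibleD[OF that, of 1 1 0] l by (simp add: link_energy_def w_def)
    thus False using w0 q by argo
  qed
  have no23b: False if "admissible l 2 3 e m m" for e
  proof -
    have "(2 + 2 * l) * w \<le> 2 * (q - m)"
      using admissibleD[OF that, of 0 1 1] l by (simp add: link_energy_def w_def)
    hence "(2 + 2 * l) * w \<le> (2 * s) * w" by (simp add: qmw)
    hence "2 + 2 * l \<le> 2 * s" using w0 by simp
    thus False using l2 t1 by (simp add: t_def)
  qed
  \<comment> \<open>The middle centre has the smaller degree and gets the smaller weight 3/4. Since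
    \<open>t < 2 / 7\<close> gives \<open>w \<ge> 7 / 16 * (q - m)\<close>, the inequality would
    require \<open>q - m \<ge> 240 / 337\<close>, just above the bound 7/10.\<close>
  have no23c: False if "admissible l 2 3 m (m - 1) m"
  proof -
    have "3 / 2 + 9 / 16 * w \<le> (q - m) + (q - m + 1) * (9 / 16)"
      using admissibleD[OF that, of 1 "3 / 4" 0] m unfolding link_energy_def l(2)
      by (simp add: w_def power2_eq_square of_nat_diff algebra_simps)
    moreover have "w \<ge> 7 / 16 * (q - m)"
    proof -
      have "7 / 16 * (q - m) = (7 / 16 * s) * w" by (simp add: qmw)
      also have "\<dots> \<le> 1 * w" using w0 t1 by (intro mult_right_mono) (auto simp: t_def)
      finally show ?thesis by simp
    qed
    ultimately show False using d1 by argo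
  qed
  have no33a: False if "admissible l 3 3 m m e" for e
  proof -
    have "3 + 2 * l \<le> (q - 1) * ((q - m) + (q - m))"
      using admissible_33D[OF that l1, of 1 1 0] l by simp
    also have "\<dots> = 2 * s" using s(1) by (simp add: algebra_simps)
    finally show False using l2 t1 by (simp add: t_def)
  qed
  have m1: "(q - 1) * (q - m) = s" "(q - 1) * (q - real (m - 1)) = s + q - 1"
    using s(1) m by (simp_all add: of_nat_diff algebra_simps)
  \<comment> \<open>Here the equation at the outer centres is \<open>(q + t) * x = l * y\<close>;
    neglecting \<open>t\<close>, it is solved by the test point \<open>(l, q, l)\<close>.\<close>
  have no33b: False if "admissible l 3 3 (m - 1) m (m - 1)"
  proof -
    have "l\<^sup>2 + 2 * q\<^sup>2 + l\<^sup>2 + 2 * l * q * (l + l) \<le>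
        (q - 1) * ((q - real (m - 1)) * l\<^sup>2 + (q - m) * q\<^sup>2 + (q - real (m - 1)) * l\<^sup>2)"
      using admissible_33D[OF that l1, of l q l] l q4 by simp
    also have "\<dots> = 2 * ((q - 1) * (q - real (m - 1))) * q + ((q - 1) * (q - m)) * q\<^sup>2"
      unfolding l(2) by (simp add: algebra_simps)
    finally have "l\<^sup>2 + 2 * q\<^sup>2 + l\<^sup>2 + 2 * l * q * (l + l) \<le> 2 * (s + q - 1) * q + s * q\<^sup>2"
      unfolding m1 .
    moreover have "l\<^sup>2 + 2 * q\<^sup>2 + l\<^sup>2 + 2 * l * q * (l + l) = 2 * q + 6 * q\<^sup>2"
      using l(2) by (simp add: power2_eq_square algebra_simps)
    ultimately have "q * (2 + 6 * q) \<le> q * (2 * (s + q - 1) + s * q)"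
      by (simp add: power2_eq_square algebra_simps)
    hence "2 + 6 * q \<le> 2 * s + 2 * q - 2 + s * q" using q4 by simp
    moreover have "s * q \<le> 3 * q" using t1 q4 by (intro mult_right_mono) (auto simp: t_def)
    ultimately show False using t1 q4 unfolding t_def by linarith
  qed
  \<comment> \<open>The test point \<open>(q, l * k, k)\<close> solves the equation
    \<open>k * x = l * y\<close> at the first centre exactly, and \<open>(q + t) * z = l * y\<close>
    at the third up to \<open>t\<close>.\<close>
  have no33c: False if "admissible l 3 3 m (m - 1) (m - 1)"
  proof -
    define k where "k = 1 + t"
    have sk: "s = k + 1" by (simp add: k_def t_def)
    have k: "k > 1" using t0 by (simp add: k_def)
    have kr: "k * (2 * q - 3 + k) = 2 * q" using troot by (simp add: k_def algebra_simps)
    have "q\<^sup>2 + 2 * (l * k)\<^sup>2 + k\<^sup>2 + 2 * l * (l * k) * (q + k) \<le>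
        (q - 1) * ((q - m) * q\<^sup>2 + (q - real (m - 1)) * (l * k)\<^sup>2 + (q - real (m - 1)) * k\<^sup>2)"
      using admissible_33D[OF that l1, of q "l * k" k] l q4 k by simp
    also have "\<dots> = ((q - 1) * (q - m)) * q\<^sup>2 + ((q - 1) * (q - real (m - 1))) * (q * k\<^sup>2 + k\<^sup>2)"
      unfolding l(2) power_mult_distrib by (simp add: algebra_simps)
    also have "\<dots> = (k + 1) * q\<^sup>2 + (k + q) * (q * k\<^sup>2 + k\<^sup>2)" unfolding m1 sk by simp
    finally have *: "q\<^sup>2 + 2 * (l * k)\<^sup>2 + k\<^sup>2 + 2 * l * (l * k) * (q + k) \<le> (k + 1) * q\<^sup>2 + (k + q) * (q * k\<^sup>2 + k\<^sup>2)" .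
    have "q\<^sup>2 + 2 * (q * k\<^sup>2) + k\<^sup>2 + 2 * q * k * (q + k) \<le> (k + 1) * q\<^sup>2 + (k + q) * (q * k\<^sup>2 + k\<^sup>2)"
    proof -
      have "(l * k)\<^sup>2 = q * k\<^sup>2" "2 * l * (l * k) = 2 * q * k"
        using l(2) by (auto simp: power2_eq_square)
      with * show ?thesis by simp
    qed
    hence "k * (2 * q * k + k + 2 * q * (q + k)) \<le> k * (q\<^sup>2 + (k + q) * (q * k + k))"
      by (simp add: power2_eq_square algebra_simps)
    hence "2 * q * k + k + 2 * q * (q + k) \<le> q\<^sup>2 + (k + q) * (q * k + k)" using k by simp
    hence A: "2 * (2 * q * k + k + 2 * q * (q + k)) \<le> 2 * q\<^sup>2 + 2 * (k + q) * (q * k + k)" by (simp add: algebra_simps)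
    \<comment> \<open>The root equation eliminates the square of \<open>k\<close>. With
      \<open>k = 1 + t\<close> the inequality becomes
      \<open>2 * q * (q * t) + 4 * (q * t) \<le> 4 + 4 * t\<close>, which fails because
      \<open>q * t > 1\<close>.\<close>
    have kk: "k * k = 2 * q + 3 * k - 2 * q * k" using kr by (simp add: algebra_simps)
    have "2 * (k + q) * (q * k + k) = 2 * (q + 1) * (k * k) + 2 * q * (q + 1) * k" by (simp add: algebra_simps)
    also have "\<dots> = 2 * (q + 1) * (2 * q + 3 * k - 2 * q * k) + 2 * q * (q + 1) * k" unfolding kk ..
    finally have B: "2 * (k + q) * (q * k + k) = 4 * q\<^sup>2 + 4 * q + 6 * k + 4 * q * k - 2 * q\<^sup>2 * k"
      by (simp add: algebra_simps power2_eq_square)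
    from A B have C: "2 * q\<^sup>2 * k + 4 * q * k \<le> 2 * q\<^sup>2 + 4 * q + 4 * k"
      by (simp add: algebra_simps power2_eq_square)
    have "2 < t * (2 * q)"
    proof -
      have "2 = t * (2 * q - 1 + t)" using troot by (simp add: algebra_simps)
      also have "\<dots> < t * (2 * q)" using t0 t1 by (intro mult_strict_left_mono) auto
      finally show ?thesis .
    qed
    hence qt: "q * t > 1" by (simp add: mult_ac)
    hence "2 * q * 1 < 2 * q * (q * t)" using q4 by (intro mult_strict_left_mono) auto
    moreover have "2 * q * (q * t) + 4 * (q * t) \<le> 4 + 4 * t"
      using C by (simp add: k_def algebra_simps power2_eq_square)
    ultimately show False using qt t1 q4 by linarith
  qed
  have "p + r \<ge> 4" using sum em by linarith
  then consider "p = 1" "r = 3" | "p = 3" "r = 1" | "p = 2" "r = 2" | "p = 2" "r = 3" | "p = 3" "r = 2" | "p = 3" "r = 3"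
    using pr by auto
  thus ?thesis
  proof cases
    case 1
    hence "e1 = m" "e2 = m" "e3 = m" using sum em by linarith+
    thus ?thesis using no13 adm 1 by blast
  next
    case 2
    hence "e1 = m" "e2 = m" "e3 = m" using sum em by linarith+
    thus ?thesis using no13 adm 2 admissible_sym by blast
  next
    case 3
    hence "e1 = m" "e2 = m" "e3 = m" using sum em by linarith+
    thus ?thesis using no22 adm 3 by blast
  next
    case 4
    consider "e1 = m" "e2 = m" | "e2 = m" "e3 = m" | "e1 = m" "e2 = m - 1" "e3 = m"
      using sum em 4 m by linarith
    thus ?thesis using no23a[of e3] no23b[of e1] no23c adm 4 by cases auto
  next
    case 5
    have adm': "admissible l 2 3 e3 e2 e1" using adm 5 admissible_sym by blast
    consider "e1 = m" "e2 = m" | "e2 = m" "e3 = m" | "e1 = m" "e2 = m - 1" "e3 = m"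
      using sum em 5 m by linarith
    thus ?thesis using no23a[of e1] no23b[of e3] no23c adm' by cases auto
  next
    case 6
    have adm': "admissible l 3 3 e3 e2 e1" using adm 6 admissible_sym by blast
    have sum': "e1 + e2 + e3 + 2 = 3 * m" using sum 6 by simp
    consider "e2 = m" | "e2 = m - 1" | "e2 = m - 2" using sum' em m by linarith
    thus ?thesis
    proof cases
      case 1
      consider "e1 = m" | "e3 = m" | "e1 = m - 1" "e3 = m - 1" using sum' em m 1 by linarith
      thus ?thesis using no33a[of e1] no33a[of e3] no33b adm adm' 6 1 by cases auto
    next
      case 2
      consider "e1 = m" "e3 = m - 1" | "e1 = m - 1" "e3 = m" using sum' em m 2 by linarith
      thus ?thesis using no33c adm adm' 6 2 by cases auto
    next
      case 3
      have "e1 = m" "e3 = m" using sum' em m 3 by linarith+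
      thus ?thesis using 6 3 by blast
    qed
  qed
qed

text \<open>The degrees are below \<open>m\<close>, while \<open>p + r \<le> 6\<close> makes their
  sum at least \<open>3 * m - 3\<close>; so all these bounds are attained.\<close>

lemma classification_mod3_0_large:
  fixes q :: real and m :: nat
  assumes q: "q \<le> m" and pr: "p \<in> {1, 2, 3}" "r \<in> {1, 2, 3}" and sum: "e1 + e2 + e3 + p + r = 3 * m + 3"
    and e: "real e1 < q" "real e2 < q" "real e3 < q"
  shows "p = 3 \<and> r = 3 \<and> e1 = m - 1 \<and> e2 = m - 1 \<and> e3 = m - 1"
proof -
  have "e1 < m" "e2 < m" "e3 < m" using e q by linarith+
  moreover have "p \<le> 3" "r \<le> 3" using pr by auto
  ultimately show ?thesis using sum by linarith
qed

text \<open>Here \<open>q\<close> lies slightly above \<open>m\<close>, so the degree bound still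
  permits \<open>m\<close>. Every case but the extremal one has a centre of degree \<open>m\<close>
  linked to one of degree at least \<open>m - 3\<close>, and a test point on such a pair refutes
  it.\<close>

lemma classification_mod3_0_small:
  fixes l q :: real and m :: nat
  assumes l: "l > 0" "l\<^sup>2 = q" and q: "(m = 4 \<and> q \<ge> 43 / 10 \<and> q \<le> 44 / 10) \<or> (m = 5 \<and> q \<ge> 51 / 10 \<and> q \<le> 52 / 10)"
    and pr: "p \<in> {1, 2, 3}" "r \<in> {1, 2, 3}" and sum: "e1 + e2 + e3 + p + r = 3 * m + 3"
    and e: "real e1 < q" "real e2 < q" "real e3 < q" and adm: "admissible l p r e1 e2 e3"
  shows "p = 3 \<and> r = 3 \<and> e1 = m - 1 \<and> e2 = m - 1 \<and> e3 = m - 1"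
proof -
  have q4: "q \<ge> 4" "q \<le> m + 4 / 10" "m \<ge> 4" using q by auto
  have l2: "l \<ge> 2" using l q4 by (intro power2_le_imp_le[of 2 l]) auto
  have l1: "l > 1" using l2 by simp
  have em: "e1 \<le> m" "e2 \<le> m" "e3 \<le> m" using e q4 by linarith+
  define w where "w = 1 / (q - 1)"
  have w0: "w > 0" using q4 by (simp add: w_def)
  have E3: "link_energy 3 l x 0 = x\<^sup>2 * w" "link_energy 3 l 0 x = x\<^sup>2 * w" for x
    using l by (simp_all add: link_energy_def w_def)
  have no1: False if "admissible l 1 r' d1 d2 d3" "r' \<in> {2, 3}" "d1 + d2 \<ge> 2 * m - 1" for r' d1 d2 d3
  proof -
    have "link_energy r' l 1 0 \<ge> 0" using that(2) w0 E3(1)[of 1] by (auto simp: link_energy_def)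
    hence "2 * l - 2 \<le> 2 * q - real (d1 + d2)"
      using admissibleD[OF that(1), of 1 1 0] l by (simp add: link_energy_def)
    moreover have "real (d1 + d2) \<ge> 2 * real m - 1" using that(3) q4 by linarith
    ultimately show False using l2 q4 by linarith
  qed
  have no22: False if "admissible l 2 2 d1 d2 d3" "d1 + d2 \<ge> 2 * m - 1" for d1 d2 d3
  proof -
    have "2 \<le> 2 * q - real (d1 + d2)"
      using admissibleD[OF that(1), of 1 1 0] l by (simp add: link_energy_def)
    moreover have "real (d1 + d2) \<ge> 2 * real m - 1" using that(2) q4 by linarith
    ultimately show False using q4 by argo
  qed
  \<comment> \<open>With weight 2/5 the right side is at most
    \<open>4 / 10 + 24 / 10 * (4 / 25) = 784 / 1000\<close>, just below 4/5.\<close>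
  have no23a: False if "admissible l 2 3 m d2 d3" "d2 + 2 \<ge> m" for d2 d3
  proof -
    have "4 / 5 \<le> (q - m) + (q - d2) * (4 / 25)"
      using admissibleD[OF that(1), of 1 "2 / 5" 0] w0
      unfolding E3 l(2) by (simp add: link_energy_def[of 2] power2_eq_square) argo
    moreover have "real d2 \<ge> real m - 2" using that(2) by linarith
    ultimately show False using q4 by argo
  qed
  have no23b: False if "admissible l 2 3 d1 m d3" "d1 + 2 \<ge> m" for d1 d3
  proof -
    have "4 / 5 \<le> (q - m) + (q - d1) * (4 / 25)"
      using admissibleD[OF that(1), of "2 / 5" 1 0] w0
      unfolding E3 l(2) by (simp add: link_energy_def[of 2] power2_eq_square) argo
    moreover have "real d1 \<ge> real m - 2" using that(2) by linarith
    ultimately show False using q4 by argo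
  qed
  \<comment> \<open>The estimate for weights 1 and 1/5 on a link of length 3. Multiplied by 25, the
    right side is at least 46 and the left side at most 45.56 for \<open>m = 4\<close> and 34.44 for
    \<open>m = 5\<close>, so the upper bound 44/10 is nearly as weak as it can be.\<close>
  have key: "(q - 1) * ((q - m) + (q - (real m - 3)) / 25) < 26 / 25 + 2 / 5 * l"
  proof -
    have "(q - 1) * ((q - m) + (q - (real m - 3)) / 25) < 26 / 25 + 4 / 5"
    proof -
      have "(q - 1) * (26 * q - 26 * m + 3) < 46"
        using q
      proof
        assume "m = 4 \<and> q \<ge> 43 / 10 \<and> q \<le> 44 / 10"
        hence "(q - 1) * (26 * q - 26 * m + 3) \<le> 34 / 10 * (26 * (44 / 10) - 26 * 4 + 3)"
          by (intro mult_mono) auto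
        thus ?thesis by simp
      next
        assume "m = 5 \<and> q \<ge> 51 / 10 \<and> q \<le> 52 / 10"
        hence "(q - 1) * (26 * q - 26 * m + 3) \<le> 42 / 10 * (26 * (52 / 10) - 26 * 5 + 3)"
          by (intro mult_mono) auto
        thus ?thesis by simp
      qed
      moreover have eq: "(q - m) + (q - (real m - 3)) / 25 = (26 * q - 26 * m + 3) / 25"
        by (simp add: field_simps)
      ultimately show ?thesis unfolding eq by simp
    qed
    thus ?thesis using l2 by linarith
  qed
  have L3: "link_energy 3 l 1 (1 / 5) = (26 / 25 + 2 / 5 * l) * w" "link_energy 3 l (1 / 5) 1 = (26 / 25 + 2 / 5 * l) * w"
    using l by (simp_all add: link_energy_def w_def power2_eq_square field_simps)
  have key': "(q - m) + (q - d) / 25 < (26 / 25 + 2 / 5 * l) * w" if "d + 3 \<ge> m" for d :: nat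
  proof -
    have "(q - m) + (q - d) / 25 \<le> (q - m) + (q - (real m - 3)) / 25" using that by simp
    also have "\<dots> = ((q - 1) * ((q - m) + (q - (real m - 3)) / 25)) * w" using q4 by (simp add: w_def)
    also have "\<dots> < (26 / 25 + 2 / 5 * l) * w" using key w0 by (intro mult_strict_right_mono) auto
    finally show ?thesis .
  qed
  have no33a: False if "admissible l p' 3 d1 d2 m" "p' \<in> {2, 3}" "d2 + 3 \<ge> m" for p' d1 d2
  proof -
    have "link_energy p' l 0 (1 / 5) \<ge> 0" using that(2) w0 E3(2)[of "1 / 5"] by (auto simp: link_energy_def[of 2])
    hence "(26 / 25 + 2 / 5 * l) * w \<le> (q - m) + (q - d2) / 25"
      using admissibleD[OF that(1), of 0 "1 / 5" 1] l L3 by (simp add: power2_eq_square)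
    thus False using key'[OF that(3)] by linarith
  qed
  have no33b: False if "admissible l 3 3 d1 m d3" "d1 + 3 \<ge> m" for d1 d3
  proof -
    have "(26 / 25 + 2 / 5 * l) * w \<le> (q - m) + (q - d1) / 25"
      using admissibleD[OF that(1), of "1 / 5" 1 0] l L3 E3(1)[of 1] w0 by (simp add: power2_eq_square)
    thus False using key'[OF that(2)] by linarith
  qed
  \<comment> \<open>Reversing the order of the stars lets the shorter link come first.\<close>
  have main: "p' = 3 \<and> r' = 3 \<and> d1 = m - 1 \<and> d2 = m - 1 \<and> d3 = m - 1"
    if pr': "p' \<in> {1, 2, 3}" "r' \<in> {1, 2, 3}" "p' \<le> r'" and sum': "d1 + d2 + d3 + p' + r' = 3 * m + 3"
      and dm: "d1 \<le> m" "d2 \<le> m" "d3 \<le> m" and adm': "admissible l p' r' d1 d2 d3" for p' r' d1 d2 d3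
  proof -
    have "p' + r' \<ge> 3" using sum' dm by linarith
    then consider "p' = 1" "r' \<in> {2, 3}" | "p' = 2" "r' = 2" | "p' = 2" "r' = 3" | "p' = 3" "r' = 3"
      using pr' by auto
    thus ?thesis
    proof cases
      case 1
      have "d1 + d2 \<ge> 2 * m - 1" using 1 sum' dm by auto
      thus ?thesis using no1 adm' 1 by blast
    next
      case 2
      have "d1 + d2 \<ge> 2 * m - 1" using 2 sum' dm by auto
      thus ?thesis using no22 adm' 2 by blast
    next
      case 3
      consider "d1 = m" "d2 + 2 \<ge> m" | "d2 = m" "d1 + 2 \<ge> m" | "d3 = m" "d2 + 3 \<ge> m"
        using sum' dm 3 by linarith
      thus ?thesis using no23a[of d2 d3] no23b[of d1 d3] no33a[of 2 d1 d2] adm' 3 by cases auto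
    next
      case 4
      consider "d1 = m" "d2 + 3 \<ge> m" | "d2 = m" "d1 + 3 \<ge> m" | "d3 = m" "d2 + 3 \<ge> m"
        | "d1 = m - 1" "d2 = m - 1" "d3 = m - 1"
        using sum' dm 4 by linarith
      thus ?thesis
        using no33a[of 3 d1 d2] no33a[of 3 d3 d2] no33b[of d1 d3] adm' admissible_sym[of l 3 3 d1 d2 d3] 4
        by cases auto
    qed
  qed
  show ?thesis
  proof (cases "p \<le> r")
    case True
    show ?thesis by (rule main[OF pr True sum em adm])
  next
    case False
    have "r = 3 \<and> p = 3 \<and> e3 = m - 1 \<and> e2 = m - 1 \<and> e1 = m - 1"
      by (rule main) (use pr False sum em adm admissible_sym in auto)
    thus ?thesis by blast
  qed
qed

section \<open>Locating the extremal root for each residue of n modulo 3\<close>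

lemma root_between:
  fixes F :: "real \<Rightarrow> real"
  assumes "F x \<le> 0" "0 \<le> F y" "x \<le> y" "continuous_on UNIV F"
  obtains q where "x \<le> q" "q \<le> y" "F q = 0"
  using IVT'[of F x 0 y] assms continuous_on_subset[OF assms(4), of "{x..y}"] by auto

lemma minimal_rho_mod3_0:
  assumes n: "n \<ge> 11" "n = 3 * m" and G: "G \<in> conn_graphs_dom n 3"
  shows "rho G \<ge> rho (G2 (m - 2) (m - 3) (m - 2)) \<and>
    (rho G = rho (G2 (m - 2) (m - 3) (m - 2)) \<longleftrightarrow>
      digraph_iso (with_proj G) (with_proj (G2 (m - 2) (m - 3) (m - 2))))"
proof -
  have m: "m \<ge> 4" using n by linarith
  \<comment> \<open>The equation \<open>eq\<close> of \<open>rho_G2_symmetric\<close> with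
    \<open>q\<close> for \<open>l\<^sup>2\<close>, all three centres having degree
    \<open>m - 1\<close>.\<close>
  define F :: "real \<Rightarrow> real" where
    "F q = ((q - (real m - 1)) * (q - 1) - 2) * ((q - (real m - 1)) * (q - 1) - 1) - 2 * q" for q
  have cont: "continuous_on UNIV F" unfolding F_def by (intro continuous_intros)
  have "\<exists>q. F q = 0 \<and> q > 1 \<and> (q - (real m - 1)) * (q - 1) > 1 \<and>
      ((m = 4 \<and> q \<ge> 43 / 10 \<and> q \<le> 44 / 10) \<or> (m = 5 \<and> q \<ge> 51 / 10 \<and> q \<le> 52 / 10) \<or> q \<le> m)"
  proof -
    \<comment> \<open>\<open>F m = (m - 1) * (m - 6)\<close> is nonnegative from
      \<open>m = 6\<close> on, so there a root exists up to \<open>m\<close>. For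
      \<open>m = 4\<close> and \<open>m = 5\<close> it is negative, and the root is bracketed
      numerically above \<open>m\<close>.\<close>
    consider "m = 4" | "m = 5" | "m \<ge> 6" using m by linarith
    thus ?thesis
    proof cases
      case 1
      obtain q where q: "43 / 10 \<le> q" "q \<le> 44 / 10" "F q = 0"
        by (rule root_between[OF _ _ _ cont, of "43 / 10" "44 / 10"]) (simp_all add: F_def 1)
      have "13 / 10 * (33 / 10) \<le> (q - (real m - 1)) * (q - 1)"
        using q 1 by (intro mult_mono) auto
      thus ?thesis using q 1 by (intro exI[of _ q]) auto
    next
      case 2
      obtain q where q: "51 / 10 \<le> q" "q \<le> 52 / 10" "F q = 0"
        by (rule root_between[OF _ _ _ cont, of "51 / 10" "52 / 10"]) (simp_all add: F_def 2)
      have "11 / 10 * (41 / 10) \<le> (q - (real m - 1)) * (q - 1)"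
        using q 2 by (intro mult_mono) auto
      thus ?thesis using q 2 by (intro exI[of _ q]) auto
    next
      case 3
      \<comment> \<open>Chosen so that the product in \<open>tx\<close> is
        \<open>1 + u\<^sup>2\<close>, just above 1. This makes \<open>F x \<le> 0\<close>, and the
        product stays above 1 to the right of \<open>x\<close>, so the root found has
        \<open>P > 0\<close>.\<close>
      define u where "u = 1 / (real m - 2)"
      have u: "u > 0" "u \<le> 1 / 4" "u * (real m - 2) = 1" using 3 by (auto simp: u_def field_simps)
      define x where "x = real m - 1 + u"
      have tx: "(x - (real m - 1)) * (x - 1) = 1 + u\<^sup>2"
        using u(3) by (simp add: x_def algebra_simps power2_eq_square)
      have u2: "u\<^sup>2 > 0" "u\<^sup>2 \<le> 1 / 16"
        using u power_mono[OF u(2), of 2] by (auto simp: power2_eq_square)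
      have "F x = (u\<^sup>2 - 1) * u\<^sup>2 - 2 * x" unfolding F_def tx by simp
      moreover have "(u\<^sup>2 - 1) * u\<^sup>2 \<le> 0" using u2 by (intro mult_nonpos_nonneg) auto
      ultimately have "F x \<le> 0" using u 3 by (simp add: x_def)
      moreover have "F m \<ge> 0"
      proof -
        have "F m = (real m - 1) * (real m - 6)" by (simp add: F_def algebra_simps)
        thus ?thesis using 3 by simp
      qed
      moreover have "x \<le> m" using u by (simp add: x_def)
      ultimately obtain q where q: "x \<le> q" "q \<le> m" "F q = 0"
        using root_between[OF _ _ _ cont] by blast
      have "(x - (real m - 1)) * (x - 1) \<le> (q - (real m - 1)) * (q - 1)"
        using q u 3 by (intro mult_mono) (auto simp: x_def)
      hence "(q - (real m - 1)) * (q - 1) > 1" using u2(1) unfolding tx by linarith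
      moreover have "q > 1" using q(1) u 3 by (simp add: x_def)
      ultimately show ?thesis using q by blast
    qed
  qed
  then obtain q where q: "F q = 0" "q > 1" "(q - (real m - 1)) * (q - 1) > 1"
      "(m = 4 \<and> q \<ge> 43 / 10 \<and> q \<le> 44 / 10) \<or> (m = 5 \<and> q \<ge> 51 / 10 \<and> q \<le> 52 / 10) \<or> q \<le> m"
    by blast
  define l where "l = sqrt q"
  have l: "l > 1" "l > 0" "l\<^sup>2 = q" using q(2) by (auto simp: l_def)
  have "rho G \<ge> rho (G2 (m - 1 - 1) (m - 1 - 2) (m - 1 - 1)) \<and>
    (rho G = rho (G2 (m - 1 - 1) (m - 1 - 2) (m - 1 - 1)) \<longleftrightarrow>
      digraph_iso (with_proj G) (with_proj (G2 (m - 1 - 1) (m - 1 - 2) (m - 1 - 1))))"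
  proof (rule minimal_rho_from_classification[OF G l(1) refl])
    show "0 < (l\<^sup>2 - real (m - 1)) * (l\<^sup>2 - 1) - 1" using q(3) m l by (simp add: of_nat_diff)
    show "((l\<^sup>2 - real (m - 1)) * (l\<^sup>2 - 1) - 2) * ((l\<^sup>2 - real (m - 1)) * (l\<^sup>2 - 1) - 1) = 2 * l\<^sup>2"
      using q(1) m l by (simp add: F_def of_nat_diff)
    fix p r e1 e2 e3 :: nat
    assume A: "p \<in> {1, 2, 3}" "r \<in> {1, 2, 3}" "e1 + e2 + e3 + p + r = n + 3"
      "real e1 < l\<^sup>2" "real e2 < l\<^sup>2" "real e3 < l\<^sup>2" "admissible l p r e1 e2 e3"
    show "p = 3 \<and> r = 3 \<and> e1 = m - 1 \<and> e2 = m - 1 \<and> e3 = m - 1"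
    proof (cases "q \<le> m")
      case True
      show ?thesis by (rule classification_mod3_0_large[OF True A(1,2)]) (use A n l in auto)
    next
      case False
      show ?thesis by (rule classification_mod3_0_small[OF l(2,3) _ A(1,2)]) (use A n l q(4) False in auto)
    qed
  qed (use m in auto)
  thus ?thesis using m by (simp add: numeral_eq_Suc)
qed

lemma minimal_rho_mod3_1:
  assumes n: "n \<ge> 11" "n = 3 * m + 1" and G: "G \<in> conn_graphs_dom n 3"
  shows "rho G \<ge> rho (G2 (m - 1) (m - 4) (m - 1)) \<and>
    (rho G = rho (G2 (m - 1) (m - 4) (m - 1)) \<longleftrightarrow>
      digraph_iso (with_proj G) (with_proj (G2 (m - 1) (m - 4) (m - 1))))"
proof -
  have m: "m \<ge> 4" using n by linarith
  define S :: "real \<Rightarrow> real" where "S q = (q - m) * (q - 1)" for q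
  \<comment> \<open>The root equation for degrees \<open>m\<close>, \<open>m - 2\<close>,
    \<open>m\<close>: there \<open>P = S q - 1\<close>, and the factor of the middle centre is
    \<open>S q + 2 * q - 4\<close>.\<close>
  define F :: "real \<Rightarrow> real" where "F q = (S q - 1) * (S q + 2 * q - 4) - 2 * q" for q
  have cont: "continuous_on UNIV F" unfolding F_def S_def by (intro continuous_intros)
  \<comment> \<open>Again a left end \<open>x\<close> at which \<open>S x = 1 + u\<^sup>2\<close> is
    barely above 1, so that the root has \<open>P > 0\<close>.\<close>
  define u where "u = 1 / (real m - 1)"
  have u: "u > 0" "u \<le> 1 / 3" "u * (real m - 1) = 1" using m by (auto simp: u_def field_simps)
  define x where "x = m + u"
  have u2: "u\<^sup>2 > 0" "u\<^sup>2 \<le> 1 / 9"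
    using u power_mono[OF u(2), of 2] by (auto simp: power2_eq_square)
  have Sx: "S x = 1 + u\<^sup>2"
    using u(3) by (simp add: S_def x_def algebra_simps power2_eq_square)
  have x4: "x \<ge> 4" using u(1) m by (simp add: x_def)
  hence "u\<^sup>2 * (u\<^sup>2 + 2 * x - 3) \<le> 1 * (2 * x)"
    using u2 by (intro mult_mono) linarith+
  hence Fx: "F x \<le> 0" unfolding F_def Sx by simp
  have F1: "F (real m + 1) > 0"
  proof -
    have "F (real m + 1) = real m * (3 * real m - 7)" by (simp add: F_def S_def algebra_simps)
    thus ?thesis using m by simp
  qed
  obtain q where q: "x \<le> q" "q \<le> real m + 1" "F q = 0"
    by (rule root_between[OF Fx _ _ cont, of "real m + 1"]) (use F1 u in \<open>auto simp: x_def\<close>)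
  have qm: "m < q" "q < real m + 1" using q u F1 by (auto simp: x_def less_le)
  have "S x \<le> S q" unfolding S_def using q u m by (intro mult_mono) (auto simp: x_def)
  hence S1: "S q > 1" using Sx u2(1) by linarith
  \<comment> \<open>For \<open>1 < S q \<le> 2\<close> the product is at most
    \<open>2 * q - 2\<close>, but at the root it equals \<open>2 * q\<close>.\<close>
  have S2: "S q > 2"
  proof (rule ccontr)
    assume "\<not> S q > 2"
    hence "(S q - 1) * (S q + 2 * q - 4) \<le> 1 * (2 * q - 2)" using S1 qm m by (intro mult_mono) auto
    thus False using q(3) by (simp add: F_def)
  qed
  define l where "l = sqrt q"
  have l: "l > 1" "l > 0" "l\<^sup>2 = q" using qm m by (auto simp: l_def)
  have "rho G \<ge> rho (G2 (m - 1) (m - 2 - 2) (m - 1)) \<and>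
    (rho G = rho (G2 (m - 1) (m - 2 - 2) (m - 1)) \<longleftrightarrow>
      digraph_iso (with_proj G) (with_proj (G2 (m - 1) (m - 2 - 2) (m - 1))))"
  proof (rule minimal_rho_from_classification[OF G l(1) refl])
    show "0 < (l\<^sup>2 - real m) * (l\<^sup>2 - 1) - 1" using S1 l by (simp add: S_def)
    have E: "((q - real (m - 2)) * (q - 1) - 2) = S q + 2 * q - 4"
      using m by (simp add: S_def of_nat_diff algebra_simps)
    show "((l\<^sup>2 - real (m - 2)) * (l\<^sup>2 - 1) - 2) * ((l\<^sup>2 - real m) * (l\<^sup>2 - 1) - 1) = 2 * l\<^sup>2"
      unfolding l(3) E S_def[symmetric] using q(3) by (simp add: F_def mult.commute)
    fix p r e1 e2 e3 :: nat
    assume A: "p \<in> {1, 2, 3}" "r \<in> {1, 2, 3}" "e1 + e2 + e3 + p + r = n + 3"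
      "real e1 < l\<^sup>2" "real e2 < l\<^sup>2" "real e3 < l\<^sup>2" "admissible l p r e1 e2 e3"
    show "p = 3 \<and> r = 3 \<and> e1 = m \<and> e2 = m - 2 \<and> e3 = m"
      by (rule classification_mod3_1[OF m l(2,3) qm S_def S2 _ A(1,2)])
         (use A n l q(3) in \<open>auto simp: F_def\<close>)
  qed (use m in auto)
  thus ?thesis by simp
qed

lemma minimal_rho_mod3_2:
  assumes n: "n \<ge> 11" "n = 3 * m + 2" and G: "G \<in> conn_graphs_dom n 3"
  shows "rho G \<ge> rho (G2 (m - 1) (m - 3) (m - 1)) \<and>
    (rho G = rho (G2 (m - 1) (m - 3) (m - 1)) \<longleftrightarrow>
      digraph_iso (with_proj G) (with_proj (G2 (m - 1) (m - 3) (m - 1))))"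
proof -
  have m: "m \<ge> 3" using n by linarith
  \<comment> \<open>With \<open>s = (q - m) * (q - 1)\<close> the root equation for degrees
    \<open>m\<close>, \<open>m - 1\<close>, \<open>m\<close> is
    \<open>(s + q - 3) * (s - 1) = 2 * q\<close>, which holds for \<open>s = 3\<close>. For
    \<open>m = 3\<close> this gives \<open>q = 4 = m + 1\<close>, so the upper bound on
    \<open>q\<close> is not strict.\<close>
  define F :: "real \<Rightarrow> real" where "F q = (q - m) * (q - 1) - 3" for q
  have cont: "continuous_on UNIV F" unfolding F_def by (intro continuous_intros)
  obtain q :: real where q: "real m \<le> q" "q \<le> real m + 1" "F q = 0"
    by (rule root_between[OF _ _ _ cont, of m "real m + 1"]) (use m in \<open>auto simp: F_def\<close>)
  have root: "(q - m) * (q - 1) = 3" using q(3) by (simp add: F_def)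
  have qm: "m < q" using q(1) root by (auto simp: less_le)
  define l where "l = sqrt q"
  have l: "l > 1" "l > 0" "l\<^sup>2 = q" using qm m by (auto simp: l_def)
  have "rho G \<ge> rho (G2 (m - 1) (m - 1 - 2) (m - 1)) \<and>
    (rho G = rho (G2 (m - 1) (m - 1 - 2) (m - 1)) \<longleftrightarrow>
      digraph_iso (with_proj G) (with_proj (G2 (m - 1) (m - 1 - 2) (m - 1))))"
  proof (rule minimal_rho_from_classification[OF G l(1) refl])
    show "0 < (l\<^sup>2 - real m) * (l\<^sup>2 - 1) - 1" using root l by simp
    have "((q - real (m - 1)) * (q - 1) - 2) = (q - m) * (q - 1) + q - 3"
      using m by (simp add: of_nat_diff algebra_simps)
    thus "((l\<^sup>2 - real (m - 1)) * (l\<^sup>2 - 1) - 2) * ((l\<^sup>2 - real m) * (l\<^sup>2 - 1) - 1) = 2 * l\<^sup>2"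
      unfolding l(3) root by simp
    fix p r e1 e2 e3 :: nat
    assume A: "p \<in> {1, 2, 3}" "r \<in> {1, 2, 3}" "e1 + e2 + e3 + p + r = n + 3"
      "real e1 < l\<^sup>2" "real e2 < l\<^sup>2" "real e3 < l\<^sup>2" "admissible l p r e1 e2 e3"
    show "p = 3 \<and> r = 3 \<and> e1 = m \<and> e2 = m - 1 \<and> e3 = m"
      by (rule classification_mod3_2[OF m l(2,3) qm q(2) root A(1,2)]) (use A n l in auto)
  qed (use m in auto)
  thus ?thesis by (simp add: numeral_eq_Suc)
qed

theorem theorem4p3:
  fixes G :: "'a pair_pre_digraph" and n m :: nat
  assumes "n \<ge> 11" and "G \<in> conn_graphs_dom n 3"
  shows
    "(n = 3 * m \<longrightarrow>
        rho G \<ge> rho (G2 (m - 2) (m - 3) (m - 2)) \<and>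
        (rho G = rho (G2 (m - 2) (m - 3) (m - 2)) \<longleftrightarrow>
           digraph_iso (with_proj G) (with_proj (G2 (m - 2) (m - 3) (m - 2))))) \<and>
     (n = 3 * m + 1 \<longrightarrow>
        rho G \<ge> rho (G2 (m - 1) (m - 4) (m - 1)) \<and>
        (rho G = rho (G2 (m - 1) (m - 4) (m - 1)) \<longleftrightarrow>
           digraph_iso (with_proj G) (with_proj (G2 (m - 1) (m - 4) (m - 1))))) \<and>
     (n = 3 * m + 2 \<longrightarrow>
        rho G \<ge> rho (G2 (m - 1) (m - 3) (m - 1)) \<and>
        (rho G = rho (G2 (m - 1) (m - 3) (m - 1)) \<longleftrightarrow>
           digraph_iso (with_proj G) (with_proj (G2 (m - 1) (m - 3) (m - 1)))))"
  using minimal_rho_mod3_0[OF assms(1) _ assms(2), of m] minimal_rho_mod3_1[OF assms(1) _ assms(2), of m]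
    minimal_rho_mod3_2[OF assms(1) _ assms(2), of m] by blast

end
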